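(* Let $K:=\mathbb C(t)^{\mathrm{alg}}$ be an algebraic closure of the rational function field $\mathbb C(t)$ and let $\sigma$ be a $\mathbb C$-algebra automorphism of $K$ with $\sigma(t)=t+1$. Let $\phi$ be the automorphism of the projective line $\mathbb P^1$ over $K$ given by $\phi([x:y])=[y:x+ty]$. Then $(\mathbb P^1,\phi)$ is wild as an inversive $\sigma$-variety over $(K,\sigma)$.
   Context: For a variety $V$ over $K$, $V^\sigma$ denotes the transform of $V$ under the action of $\sigma$ on coefficients. An inversive $\sigma$-variety $(X,\phi)$ over $(K,\sigma)$ is an absolutely irreducible variety $X$ over $K$ with an isomorphism $\phi:X\to X^\sigma$ over $K$ (here $(\mathbb P^1)^\sigma=\mathbb P^1$). It is wild if the only nonempty, Zariski closed, possibly reducible subvariety $Y\subseteq X$ over $K$ such that $\phi(Y)\subseteq Y^\sigma$ is $Y=X$. *)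

theory Defs
  imports
    "HOL-Analysis.Cartesian_Space"
    "HOL-Library.Poly_Mapping"
    "HOL-Computational_Algebra.Polynomial_Factorial"
    "HOL-Algebra.Algebraic_Closure_Type"
begin

no_notation fps_nth (infixl \<open>$\<close> 75)

section \<open>Projective space\<close>

definition proportional :: "'k::field ^ 'n \<Rightarrow> 'k ^ 'n \<Rightarrow> bool" where
  "proportional v w \<longleftrightarrow> v \<noteq> 0 \<and> w \<noteq> 0 \<and> (\<exists>c. c \<noteq> 0 \<and> w = c *s v)"

lemma part_equivp_proportional: "part_equivp (proportional :: 'k::field ^ 'n \<Rightarrow> 'k ^ 'n \<Rightarrow> bool)"
proof (rule part_equivpI)
  show "\<exists>v :: 'k ^ 'n. proportional v v"
    by (rule exI[of _ 1]) (auto simp: proportional_def intro!: exI[of _ 1])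
  show "symp (proportional :: 'k ^ 'n \<Rightarrow> 'k ^ 'n \<Rightarrow> bool)"
  proof (rule sympI)
    fix v w :: "'k ^ 'n"
    assume "proportional v w"
    then obtain c where "v \<noteq> 0" "w \<noteq> 0" "c \<noteq> 0" "w = c *s v"
      by (auto simp: proportional_def)
    then have "inverse c \<noteq> 0 \<and> v = inverse c *s w"
      by (simp add: vector_smult_assoc)
    with \<open>v \<noteq> 0\<close> \<open>w \<noteq> 0\<close> show "proportional w v"
      by (auto simp: proportional_def)
  qed
  show "transp (proportional :: 'k ^ 'n \<Rightarrow> 'k ^ 'n \<Rightarrow> bool)"
  proof (rule transpI)
    fix u v w :: "'k ^ 'n"
    assume "proportional u v" "proportional v w"
    then obtain c d where "u \<noteq> 0" "w \<noteq> 0" "c \<noteq> 0" "d \<noteq> 0" "v = c *s u" "w = d *s v"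
      by (auto simp: proportional_def)
    then have "d * c \<noteq> 0 \<and> w = (d * c) *s u"
      by (simp add: vector_smult_assoc)
    with \<open>u \<noteq> 0\<close> \<open>w \<noteq> 0\<close> show "proportional u w"
      unfolding proportional_def by blast
  qed
qed

text \<open>
  Projective space of dimension \<open>CARD('n) - 1\<close> over \<open>'k\<close>: the nonzero vectors of \<open>'k ^ 'n\<close> up to
  scaling. \<open>pt v\<close> is the point with homogeneous coordinates \<open>v\<close>; it is meaningful only
  for \<open>v \<noteq> 0\<close>. The projective line is the type \<open>('k, 2) proj\<close>.
\<close>
quotient_type (overloaded) ('k, 'n) proj = "'k::field ^ 'n::finite" / partial: proportional
  morphisms proj_rep pt
  by (rule part_equivp_proportional)

section \<open>Projective varieties over an algebraically closed field\<close>

text \<open>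
  Polynomials in the variables \<open>X\<^sub>i\<close>, \<open>i :: 'n\<close>: finitely supported maps from exponent vectors to
  coefficients.
\<close>
type_synonym ('k, 'n) mpoly = "('n \<Rightarrow>\<^sub>0 nat) \<Rightarrow>\<^sub>0 'k"

definition eval_mpoly :: "('k::comm_ring_1, 'n::finite) mpoly \<Rightarrow> 'k ^ 'n \<Rightarrow> 'k" where
  "eval_mpoly f v =
     (\<Sum>m \<in> Poly_Mapping.keys f.
        Poly_Mapping.lookup f m * (\<Prod>i\<in>UNIV. v $ i ^ Poly_Mapping.lookup m i))"

definition homogeneous :: "nat \<Rightarrow> ('k::comm_ring_1, 'n::finite) mpoly \<Rightarrow> bool" where
  "homogeneous d f \<longleftrightarrow>
     (\<forall>m \<in> Poly_Mapping.keys f. (\<Sum>i\<in>UNIV. Poly_Mapping.lookup m i) = d)"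

definition vanishes_at :: "('k::field, 'n::finite) mpoly \<Rightarrow> ('k, 'n) proj \<Rightarrow> bool" where
  "vanishes_at f p \<longleftrightarrow> (\<forall>v. v \<noteq> 0 \<and> p = pt v \<longrightarrow> eval_mpoly f v = 0)"

definition zero_locus :: "('k::field, 'n::finite) mpoly set \<Rightarrow> ('k, 'n) proj set" where
  "zero_locus S = {p. \<forall>f\<in>S. vanishes_at f p}"

text \<open>
  Since the field is algebraically closed, a Zariski closed, possibly reducible subvariety over it is
  identified with its set of rational points, and absolute irreducibility is irreducibility.
\<close>
definition zariski_closed :: "('k::alg_closed_field, 'n::finite) proj set \<Rightarrow> bool" where
  "zariski_closed V \<longleftrightarrow> (\<exists>S. (\<forall>f\<in>S. \<exists>d. homogeneous d f) \<and> V = zero_locus S)"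

definition irreducible_variety :: "('k::alg_closed_field, 'n::finite) proj set \<Rightarrow> bool" where
  "irreducible_variety V \<longleftrightarrow>
     zariski_closed V \<and> V \<noteq> {} \<and>
     (\<forall>A B. zariski_closed A \<and> zariski_closed B \<and> V \<subseteq> A \<union> B \<longrightarrow> V \<subseteq> A \<or> V \<subseteq> B)"

text \<open>
  Maps that are, locally in the Zariski topology, given by homogeneous polynomials of the same
  degree without common zero.
\<close>
definition variety_morphism ::
  "('k::alg_closed_field, 'n::finite) proj set \<Rightarrow> ('k, 'm::finite) proj set
     \<Rightarrow> (('k, 'n) proj \<Rightarrow> ('k, 'm) proj) \<Rightarrow> bool" where
  "variety_morphism V W \<phi> \<longleftrightarrow>
     \<phi> ` V \<subseteq> W \<and>
     (\<forall>p\<in>V. \<exists>U d. \<exists>F :: 'm \<Rightarrow> ('k, 'n) mpoly.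
        zariski_closed (- U) \<and> p \<in> U \<and> (\<forall>i. homogeneous d (F i)) \<and>
        (\<forall>v. v \<noteq> 0 \<and> pt v \<in> V \<inter> U \<longrightarrow>
           (\<chi> i. eval_mpoly (F i) v) \<noteq> 0 \<and> \<phi> (pt v) = pt (\<chi> i. eval_mpoly (F i) v)))"

definition variety_isomorphism ::
  "('k::alg_closed_field, 'n::finite) proj set \<Rightarrow> ('k, 'm::finite) proj set
     \<Rightarrow> (('k, 'n) proj \<Rightarrow> ('k, 'm) proj) \<Rightarrow> bool" where
  "variety_isomorphism V W \<phi> \<longleftrightarrow>
     variety_morphism V W \<phi> \<and>
     (\<exists>\<psi>. variety_morphism W V \<psi> \<and> (\<forall>p\<in>V. \<psi> (\<phi> p) = p) \<and> (\<forall>q\<in>W. \<phi> (\<psi> q) = q))"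

section \<open>Inversive \<open>\<sigma>\<close>-varieties\<close>

definition field_automorphism :: "('k::field \<Rightarrow> 'k) \<Rightarrow> bool" where
  "field_automorphism \<sigma> \<longleftrightarrow>
     bij \<sigma> \<and> \<sigma> 1 = 1 \<and> (\<forall>x y. \<sigma> (x + y) = \<sigma> x + \<sigma> y) \<and> (\<forall>x y. \<sigma> (x * y) = \<sigma> x * \<sigma> y)"

text \<open>
  The transform of \<open>V\<close>: apply \<open>\<sigma>\<close> to the coefficients of all the homogeneous polynomials
  vanishing on \<open>V\<close>.
\<close>
definition transform ::
  "('k::alg_closed_field \<Rightarrow> 'k) \<Rightarrow> ('k, 'n::finite) proj set \<Rightarrow> ('k, 'n) proj set" where
  "transform \<sigma> V =
     zero_locus {Poly_Mapping.map \<sigma> f | f. (\<exists>d. homogeneous d f) \<and> (\<forall>p\<in>V. vanishes_at f p)}"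

definition inversive_sigma_variety ::
  "('k::alg_closed_field \<Rightarrow> 'k) \<Rightarrow> ('k, 'n::finite) proj set
     \<Rightarrow> (('k, 'n) proj \<Rightarrow> ('k, 'n) proj) \<Rightarrow> bool" where
  "inversive_sigma_variety \<sigma> V \<phi> \<longleftrightarrow>
     field_automorphism \<sigma> \<and> irreducible_variety V \<and> variety_isomorphism V (transform \<sigma> V) \<phi>"

definition wild ::
  "('k::alg_closed_field \<Rightarrow> 'k) \<Rightarrow> ('k, 'n::finite) proj set
     \<Rightarrow> (('k, 'n) proj \<Rightarrow> ('k, 'n) proj) \<Rightarrow> bool" where
  "wild \<sigma> V \<phi> \<longleftrightarrow>
     (\<forall>Y. Y \<noteq> {} \<and> zariski_closed Y \<and> Y \<subseteq> V \<and> \<phi> ` Y \<subseteq> transform \<sigma> Y \<longrightarrow> Y = V)"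

section \<open>The algebraic closure of \<open>\<complex>(t)\<close>\<close>

type_synonym K = "complex poly fract alg_closure"

definition const_K :: "complex \<Rightarrow> K" where
  "const_K c = to_ac (to_fract [:c:])"

definition t_K :: K where
  "t_K = to_ac (to_fract [:0, 1:])"

lift_definition phi :: "(K, 2) proj \<Rightarrow> (K, 2) proj" is
  "\<lambda>v. vector [v $ 2, v $ 1 + t_K * v $ 2]"
proof -
  fix v w :: "K ^ 2"
  assume "proportional v w"
  then obtain c where *: "v \<noteq> 0" "w \<noteq> 0" "c \<noteq> 0" "w = c *s v"
    by (auto simp: proportional_def)
  have nz: "vector [u $ 2, u $ 1 + t_K * u $ 2] \<noteq> (0 :: K ^ 2)" if "u \<noteq> 0" for u :: "K ^ 2"
    using that by (auto simp: vec_eq_iff forall_2)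
  have "vector [w $ 2, w $ 1 + t_K * w $ 2] = c *s (vector [v $ 2, v $ 1 + t_K * v $ 2] :: K ^ 2)"
    using * by (simp add: vec_eq_iff forall_2 algebra_simps)
  with nz * show "proportional (vector [v $ 2, v $ 1 + t_K * v $ 2])
                               (vector [w $ 2, w $ 1 + t_K * w $ 2] :: K ^ 2)"
    unfolding proportional_def by blast
qed

lemma phi_pt:
  assumes "x \<noteq> 0 \<or> y \<noteq> 0"
  shows "phi (pt (vector [x, y])) = pt (vector [y, x + t_K * y])"
proof -
  have "(vector [x, y] :: K ^ 2) \<noteq> 0"
    using assms by (auto simp: vec_eq_iff forall_2)
  then have "proportional (vector [x, y] :: K ^ 2) (vector [x, y])"
    by (auto simp: proportional_def intro!: exI[of _ 1])
  then show ?thesis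
    by (simp add: phi.abs_eq)
qed

end

theory Submission
  imports Defs
begin

text \<open>
  A proper nonempty closed subset is finite, so if it is invariant, then \<open>\<sigma>\<inverse> \<circ> \<phi>\<close> has a
  periodic point \<open>z\<close> on it. Take a primitive binary form \<open>F\<close> over \<open>\<complex>[t]\<close> of minimal
  degree \<open>d\<close> vanishing at \<open>z\<close>; by minimality and primitivity the substitution
  \<open>F(X, Y; t) \<mapsto> F(Y, X + t Y; t + 1)\<close>, iterated over the period, multiplies \<open>F\<close> by a constant.
  Hence \<open>F\<close> takes values of bounded \<open>t\<close>-degree at infinitely many of the convergents
  \<open>(p\<^sub>n, q\<^sub>n)\<close> of the continued fraction generated by \<open>\<phi>\<close>, although \<open>q\<^sub>n\<close> has
  degree \<open>n\<close>. Two choices of initial values give fractions that differ by \<open>t\<close> to the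
  power \<open>- 2 n\<close> only, so if \<open>d \<ge> 3\<close>, the derivative of \<open>F\<close> becomes arbitrarily small there
  along with \<open>F\<close>, which is impossible as the two are coprime. If \<open>d = 2\<close>, the discriminant of
  \<open>F\<close> is a periodic polynomial, hence a constant, hence a square, and \<open>F\<close> splits. If \<open>d = 1\<close>,
  the degrees of the coefficients of \<open>F\<close> would increase or decrease for ever.
\<close>

section \<open>Binary forms over a polynomial ring\<close>

locale comm_ring_map =
  fixes h :: "'a::comm_ring_1 \<Rightarrow> 'b::comm_ring_1"
  assumes map_add: "h (x + y) = h x + h y"
    and map_mult: "h (x * y) = h x * h y"
    and map_one: "h 1 = 1"
begin

lemma map_zero: "h 0 = 0"
  using map_add[of 0 0] by simp

lemma map_minus: "h (- x) = - h x"
  using map_add[of x "- x"] by (simp add: map_zero add_eq_0_iff)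

lemma map_diff: "h (x - y) = h x - h y"
  using map_add[of x "- y"] by (simp add: map_minus)

lemma map_sum: "h (sum f I) = (\<Sum>i\<in>I. h (f i))"
  by (induction I rule: infinite_finite_induct) (auto simp: map_zero map_add)

lemma map_prod: "h (prod f I) = (\<Prod>i\<in>I. h (f i))"
  by (induction I rule: infinite_finite_induct) (auto simp: map_one map_mult)

lemma map_power: "h (x ^ n) = h x ^ n"
  by (induction n) (auto simp: map_one map_mult)

lemma map_of_nat: "h (of_nat n) = of_nat n"
  by (induction n) (auto simp: map_zero map_one map_add)

end

section \<open>Translations of the polynomial variable and binary forms\<close>

definition shift :: "'a::idom \<Rightarrow> 'a poly \<Rightarrow> 'a poly" where
  "shift c p = pcompose p [:c, 1:]"

lemma shift_shift [simp]: "shift a (shift b p) = shift (a + b) p"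
  unfolding shift_def by (simp flip: pcompose_assoc add: pcompose_pCons add.commute)

lemma shift_0 [simp]: "shift 0 p = p"
  by (simp add: shift_def pcompose_idR)

lemma poly_shift [simp]: "poly (shift a p) x = poly p (a + x)"
  by (simp add: shift_def poly_pcompose)

lemma degree_shift [simp]: "Polynomial.degree (shift a p) = Polynomial.degree p"
  by (simp add: shift_def degree_pcompose)

lemma lead_coeff_shift: "lead_coeff (shift a p) = lead_coeff p"
  unfolding shift_def by (subst lead_coeff_comp) auto

interpretation shift: comm_ring_map "shift a"
  by unfold_locales (simp_all add: shift_def pcompose_add pcompose_mult pcompose_1)

lemma shift_const [simp]: "shift a [:c:] = [:c:]" "shift a 0 = 0" "shift a 1 = 1"
  by (simp_all add: shift_def pcompose_pCons pcompose_1)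

lemma shift_X [simp]: "shift a [:b, 1:] = [:a + b, 1:]"
  by (simp add: shift_def pcompose_pCons)

lemma shift_eq_0_iff [simp]: "shift a p = 0 \<longleftrightarrow> p = 0"
  using shift_shift[of "-a" a p] by (metis shift_0 shift_const(2) add.left_inverse)

text \<open>The binary form of degree \<open>d\<close> whose dehomogenisation is \<open>f\<close>, with coefficients mapped by \<open>h\<close>.\<close>
definition form_eval :: "('a::comm_ring_1 \<Rightarrow> 'b::comm_ring_1) \<Rightarrow> nat \<Rightarrow> 'a poly \<Rightarrow> 'b \<Rightarrow> 'b \<Rightarrow> 'b" where
  "form_eval h d f x y = (\<Sum>j\<le>d. h (Polynomial.coeff f j) * x ^ j * y ^ (d - j))"

context comm_ring_map
begin

lemma form_eval_zero: "form_eval h d 0 x y = 0"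
  by (simp add: form_eval_def map_zero)

lemma form_eval_add: "form_eval h d (f + g) x y = form_eval h d f x y + form_eval h d g x y"
  by (simp add: form_eval_def map_add sum.distrib algebra_simps)

lemma form_eval_smult: "form_eval h d (smult c f) x y = h c * form_eval h d f x y"
  by (simp add: form_eval_def map_mult sum_distrib_left algebra_simps)

lemma form_eval_sum: "form_eval h d (sum f I) x y = (\<Sum>i\<in>I. form_eval h d (f i) x y)"
  by (induction I rule: infinite_finite_induct) (auto simp: form_eval_zero form_eval_add)

lemma form_eval_Suc:
  assumes "Polynomial.degree q \<le> d"
  shows "form_eval h (Suc d) q x y = y * form_eval h d q x y"
proof -
  have "form_eval h (Suc d) q x y = (\<Sum>j\<le>d. h (Polynomial.coeff q j) * x ^ j * y ^ (Suc d - j))"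
    using assms by (simp add: form_eval_def coeff_eq_0 map_zero)
  also have "\<dots> = y * form_eval h d q x y"
    unfolding form_eval_def sum_distrib_left by (intro sum.cong refl) (simp add: Suc_diff_le)
  finally show ?thesis .
qed

lemma form_eval_pCons_0: "form_eval h (Suc d) (pCons 0 q) x y = x * form_eval h d q x y"
  unfolding form_eval_def
  by (subst sum.atMost_Suc_shift) (simp add: map_zero sum_distrib_left algebra_simps)

lemma form_eval_linear_mult:
  assumes "Polynomial.degree q \<le> d"
  shows "form_eval h (Suc d) ([:b, a:] * q) x y = (h b * y + h a * x) * form_eval h d q x y"
proof -
  have "[:b, a:] * q = smult b q + smult a (pCons 0 q)" by (simp add: mult_pCons_left)
  then show ?thesis
    by (simp only: form_eval_add form_eval_smult form_eval_Suc[OF assms] form_eval_pCons_0)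
       (simp add: algebra_simps)
qed

text \<open>The surplus degree \<open>j\<close> shows up as the factor \<open>y ^ j\<close>; each
  summand of \<open>pullback\<close> is of this kind, with \<open>i = d - j\<close>.\<close>

lemma form_eval_linear_power:
  "form_eval h (i + j) ([:b, a:] ^ i) x y = (h b * y + h a * x) ^ i * y ^ j"
proof (induction i)
  case 0
  show ?case
  proof (induction j)
    case 0
    show ?case by (simp add: form_eval_def map_one)
  next
    case (Suc j)
    then show ?case using form_eval_Suc[of "1" "j" x y] by simp
  qed
next
  case (Suc i)
  have "Polynomial.degree ([:b, a:] ^ i) \<le> i"
    by (rule order.trans[OF degree_power_le]) (simp add: degree_pCons_le)
  then have "Polynomial.degree ([:b, a:] ^ i) \<le> i + j" by simp
  from form_eval_linear_mult[OF this, of b a x y] Suc.IH show ?case by simp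
qed

lemma form_eval_scale: "form_eval h d f (c * x) (c * y) = c ^ d * form_eval h d f x y"
  unfolding form_eval_def sum_distrib_left
proof (intro sum.cong refl)
  fix j assume "j \<in> {..d}"
  then have "c ^ d = c ^ j * c ^ (d - j)" by (simp flip: power_add)
  then show "h (Polynomial.coeff f j) * (c * x) ^ j * (c * y) ^ (d - j) =
      c ^ d * (h (Polynomial.coeff f j) * x ^ j * y ^ (d - j))"
    by (simp add: power_mult_distrib)
qed

text \<open>\<open>h\<close> may kill the leading coefficient, so the sum runs up to the fixed bound
  \<open>d\<close> and not to the degree after mapping.\<close>

lemma poly_map_poly_eq_sum:
  assumes "Polynomial.degree f \<le> d"
  shows "poly (map_poly h f) z = (\<Sum>j\<le>d. h (Polynomial.coeff f j) * z ^ j)"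
proof -
  have "poly (map_poly h f) z = (\<Sum>j\<le>Polynomial.degree (map_poly h f). h (Polynomial.coeff f j) * z ^ j)"
    by (simp add: poly_altdef coeff_map_poly map_zero)
  also have "\<dots> = (\<Sum>j\<le>d. h (Polynomial.coeff f j) * z ^ j)"
  proof (rule sum.mono_neutral_left)
    have "Polynomial.degree (map_poly h f) \<le> Polynomial.degree f" 
      by (intro degree_le allI impI) (simp add: coeff_map_poly map_zero coeff_eq_0)
    then show "{..Polynomial.degree (map_poly h f)} \<subseteq> {..d}" using assms by auto
    show "\<forall>j\<in>{..d} - {..Polynomial.degree (map_poly h f)}. h (Polynomial.coeff f j) * z ^ j = 0"
    proof
      fix j assume "j \<in> {..d} - {..Polynomial.degree (map_poly h f)}"
      then have "Polynomial.coeff (map_poly h f) j = 0" by (simp add: coeff_eq_0)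
      then show "h (Polynomial.coeff f j) * z ^ j = 0" by (simp add: coeff_map_poly map_zero)
    qed
  qed simp
  finally show ?thesis .
qed

lemma map_poly_add: "map_poly h (f + g) = map_poly h f + map_poly h g"
  by (rule poly_eqI) (simp add: coeff_map_poly map_zero map_add)

lemma map_poly_smult: "map_poly h (smult c f) = smult (h c) (map_poly h f)"
  by (rule poly_eqI) (simp add: coeff_map_poly map_zero map_mult)

lemma map_poly_mult: "map_poly h (f * g) = map_poly h f * map_poly h g"
  by (rule poly_eqI) (simp add: coeff_map_poly map_zero map_mult map_sum coeff_mult)

lemma map_poly_const: "map_poly h [:c:] = [:h c:]"
  by (rule poly_eqI) (simp add: coeff_map_poly map_zero coeff_pCons split: nat.splits)

end

lemma map_poly_pderiv:
  fixes h :: "'a::idom \<Rightarrow> 'b::idom"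
  assumes "comm_ring_map h"
  shows "map_poly h (pderiv f) = pderiv (map_poly h f)"
proof -
  interpret comm_ring_map h by fact
  show ?thesis
    by (rule poly_eqI)
       (simp add: coeff_map_poly map_zero coeff_pderiv map_mult map_add map_one map_of_nat)
qed

lemma form_eval_eq_poly:
  fixes h :: "'a::comm_ring_1 \<Rightarrow> 'b::field"
  assumes "comm_ring_map h" "Polynomial.degree f \<le> d" "y \<noteq> 0"
  shows "form_eval h d f x y = y ^ d * poly (map_poly h f) (x / y)"
proof -
  interpret comm_ring_map h by fact
  show ?thesis
    unfolding form_eval_def poly_map_poly_eq_sum[OF assms(2)] sum_distrib_left
  proof (intro sum.cong refl)
    fix j assume "j \<in> {..d}"
    then have "y ^ d = y ^ j * y ^ (d - j)" by (simp flip: power_add)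
    with \<open>y \<noteq> 0\<close> show "h (Polynomial.coeff f j) * x ^ j * y ^ (d - j) =
        y ^ d * (h (Polynomial.coeff f j) * (x / y) ^ j)"
      by (simp add: field_simps)
  qed
qed

text \<open>In characteristic zero the field is infinite, so a form that vanishes at all pairs
  \<open>(z, 1)\<close> has zero dehomogenisation.\<close>

lemma form_eval_eq_0_imp_coeffs:
  fixes h :: "'a::comm_ring_1 \<Rightarrow> 'b::{field, ring_char_0}"
  assumes "comm_ring_map h" "Polynomial.degree f \<le> d" "\<And>x y. form_eval h d f x y = 0"
  shows "h (Polynomial.coeff f j) = 0"
proof -
  interpret comm_ring_map h by fact
  have "poly (map_poly h f) z = 0" for z
    using form_eval_eq_poly[OF assms(1,2), of 1 z] assms(3)[of z 1] by simp
  then have "map_poly h f = 0" using poly_all_0_iff_0 by blast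
  then show ?thesis by (metis coeff_0 coeff_map_poly map_zero)
qed

text \<open>The binary form \<open>F (Y, X + t Y)\<close> with its coefficients shifted, dehomogenised at \<open>Y = 1\<close>.\<close>
definition pullback :: "nat \<Rightarrow> 'a::idom poly poly \<Rightarrow> 'a poly poly" where
  "pullback d f = (\<Sum>j\<le>d. smult (shift 1 (Polynomial.coeff f j)) ([:[:0, 1:], 1:] ^ (d - j)))"

lemma degree_pullback: "Polynomial.degree (pullback d f) \<le> d"
  unfolding pullback_def
proof (intro degree_sum_le finite_atMost)
  fix j :: nat assume "j \<in> {..d}"
  have "Polynomial.degree (smult (shift 1 (Polynomial.coeff f j)) ([:[:0, 1:], 1:] ^ (d - j)))
      \<le> Polynomial.degree ([:[:0, 1:], 1 :: 'a poly:] ^ (d - j))" by (rule degree_smult_le)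
  also have "\<dots> \<le> 1 * (d - j)" by (rule order.trans[OF degree_power_le]) simp
  finally show "Polynomial.degree (smult (shift 1 (Polynomial.coeff f j)) ([:[:0, 1:], 1:] ^ (d - j))) \<le> d"
    by simp
qed

text \<open>Each summand of \<open>pullback\<close> is a multiple of a power of a linear form. The
  coefficient map stays arbitrary because the formula serves evaluation at a number, polynomial
  values and the embedding into \<open>K\<close>.\<close>

lemma form_eval_pullback:
  assumes "comm_ring_map h"
  shows "form_eval h d (pullback d f) x y = form_eval (\<lambda>p. h (shift 1 p)) d f y (x + h [:0, 1:] * y)"
proof -
  interpret comm_ring_map h by fact
  show ?thesis
    unfolding pullback_def form_eval_sum form_eval_smult
    unfolding form_eval_def[of "\<lambda>p. h (shift 1 p)"]
  proof (intro sum.cong refl)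
    fix j assume "j \<in> {..d}"
    then show "h (shift 1 (Polynomial.coeff f j)) * form_eval h d ([:[:0, 1:], 1:] ^ (d - j)) x y =
        h (shift 1 (Polynomial.coeff f j)) * y ^ j * (x + h [:0, 1:] * y) ^ (d - j)"
      using form_eval_linear_power[of "d - j" j "[:0, 1:]" 1 x y] by (simp add: map_one add.commute)
  qed
qed

lemma pullback_smult: "pullback d (smult c f) = smult (shift 1 c) (pullback d f)"
  by (rule poly_eqI) (simp add: pullback_def shift.map_mult coeff_sum sum_distrib_left mult.assoc)

section \<open>Minimal roots and degrees of rational functions\<close>

lemma form_eval_hom:
  assumes "comm_ring_map g"
  shows "form_eval (\<lambda>p. g (h p)) d f (g x) (g y) = g (form_eval h d f x y)"
proof -
  interpret comm_ring_map g by fact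
  show ?thesis by (simp add: form_eval_def map_sum map_mult map_power)
qed

lemma comm_ring_map_poly: "comm_ring_map (\<lambda>p. poly p a)"
  by unfold_locales auto

lemma comm_ring_map_id: "comm_ring_map (\<lambda>x. x)"
  by unfold_locales auto

lemma comm_ring_map_to_fract: "comm_ring_map to_fract"
  by unfold_locales auto

lemma degree_pullback_funpow:
  "Polynomial.degree f \<le> d \<Longrightarrow> Polynomial.degree ((pullback d ^^ n) f) \<le> d"
  by (cases n) (auto simp: degree_pullback)

lemma pullback_funpow_smult:
  "(pullback d ^^ n) (smult [:c:] f) = smult [:c:] ((pullback d ^^ n) f)"
  by (induction n) (auto simp: pullback_smult)

text \<open>At \<open>t = \<alpha>\<close> the substitution of \<open>(y, x + \<alpha> * y)\<close>
  for \<open>(x, y)\<close> is invertible, so every value of the form at \<open>1 + \<alpha>\<close>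
  is a value of its pullback at \<open>\<alpha>\<close>.\<close>

lemma coeffs_vanish_pullback:
  fixes f :: "'a::field_char_0 poly poly"
  assumes "Polynomial.degree f \<le> d" "\<And>j. poly (Polynomial.coeff (pullback d f) j) \<alpha> = 0"
  shows "poly (Polynomial.coeff f j) (1 + \<alpha>) = 0"
proof (rule form_eval_eq_0_imp_coeffs[OF comm_ring_map_poly assms(1)])
  fix x y
  \<comment> \<open>The pair \<open>(y - \<alpha> * x, x)\<close> is the preimage of
    \<open>(x, y)\<close> under that substitution.\<close>
  have "form_eval (\<lambda>p. poly p \<alpha>) d (pullback d f) (y - \<alpha> * x) x = 0"
    by (simp add: form_eval_def assms(2))
  then show "form_eval (\<lambda>p. poly p (1 + \<alpha>)) d f x y = 0"
    unfolding form_eval_pullback[OF comm_ring_map_poly] by simp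
qed

lemma coeffs_vanish_pullback_funpow:
  fixes f :: "'a::field_char_0 poly poly"
  assumes "Polynomial.degree f \<le> d" "\<And>j. poly (Polynomial.coeff ((pullback d ^^ n) f) j) \<alpha> = 0"
  shows "poly (Polynomial.coeff f j) (of_nat n + \<alpha>) = 0"
  using assms(2)
proof (induction n arbitrary: \<alpha> j)
  case (Suc n)
  have "poly (Polynomial.coeff ((pullback d ^^ n) f) j) (1 + \<alpha>) = 0" for j
    by (rule coeffs_vanish_pullback[OF degree_pullback_funpow[OF assms(1)]]) (use Suc.prems in simp)
  from Suc.IH[OF this] show ?case by (simp add: algebra_simps)
qed simp

text \<open>By pseudo-division, an element \<open>p\<close> of least degree in the ideal of
  \<open>f\<close> and \<open>g\<close> divides every element up to a nonzero scalar. As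
  \<open>p\<close> divides a multiple of \<open>g\<close>, it does not vanish at \<open>z\<close>;
  so its cofactor in a multiple of \<open>f\<close> does, and minimality of \<open>f\<close> leaves
  degree 0 for \<open>p\<close>.\<close>

lemma bezout_of_minimal_root:
  fixes h :: "'a::idom \<Rightarrow> 'b::idom"
  assumes h: "comm_ring_map h"
    and root: "poly (map_poly h f) z = 0"
    and minimal: "\<And>g. g \<noteq> 0 \<Longrightarrow> poly (map_poly h g) z = 0 \<Longrightarrow> Polynomial.degree f \<le> Polynomial.degree g"
    and f: "f \<noteq> 0" and g: "poly (map_poly h g) z \<noteq> 0"
    and inj: "\<And>a. h a = 0 \<Longrightarrow> a = 0"
  obtains a b r where "r \<noteq> 0" "a * f + b * g = [:r:]"
proof -
  interpret comm_ring_map h by fact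
  define I where "I = {a * f + b * g | a b. True}"
  have I_diff: "smult s p - q * p' \<in> I" if "p \<in> I" "p' \<in> I" for p p' q s
  proof -
    from that obtain a b a' b' where "p = a * f + b * g" "p' = a' * f + b' * g"
      by (auto simp: I_def)
    then have "smult s p - q * p' = (smult s a - q * a') * f + (smult s b - q * b') * g"
      by (simp add: algebra_simps smult_add_right)
    then show ?thesis unfolding I_def by blast
  qed
  have fI: "f \<in> I" and gI: "g \<in> I"
  proof -
    have "f = 1 * f + 0 * g" "g = 0 * f + 1 * g" by simp_all
    then show "f \<in> I" "g \<in> I" unfolding I_def by blast+
  qed
  obtain p where p: "p \<in> I" "p \<noteq> 0"
    and p_min: "\<And>q. q \<in> I \<Longrightarrow> q \<noteq> 0 \<Longrightarrow> Polynomial.degree p \<le> Polynomial.degree q"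
    using ex_has_least_nat[of "\<lambda>q. q \<in> I \<and> q \<noteq> 0" f Polynomial.degree] fI f by blast
  have mult_p: "\<exists>s q. s \<noteq> 0 \<and> smult s e = p * q" if "e \<in> I" for e
  proof -
    obtain s q where "s \<noteq> 0" and sq: "smult s e = p * q + pseudo_mod e p"
      using pseudo_mod(1)[OF p(2), of e] by blast
    have "pseudo_mod e p = smult s e - q * p" using sq by (simp add: algebra_simps)
    then have "pseudo_mod e p \<in> I" using I_diff[OF that p(1)] by simp
    moreover have "pseudo_mod e p = 0 \<or> Polynomial.degree (pseudo_mod e p) < Polynomial.degree p"
      using pseudo_mod(2)[OF p(2)] .
    ultimately have "pseudo_mod e p = 0" using p_min by (metis not_le)
    with sq \<open>s \<noteq> 0\<close> show ?thesis by auto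
  qed
  obtain s q where s: "s \<noteq> 0" "smult s f = p * q" using mult_p[OF fI] by blast
  obtain s' q' where s': "s' \<noteq> 0" "smult s' g = p * q'" using mult_p[OF gI] by blast
  have "h s' * poly (map_poly h g) z = poly (map_poly h p) z * poly (map_poly h q') z"
    using arg_cong[OF s'(2), of "\<lambda>p. poly (map_poly h p) z"] by (simp add: map_poly_smult map_poly_mult)
  with g s'(1) inj have "poly (map_poly h p) z \<noteq> 0" by fastforce
  moreover have "0 = poly (map_poly h p) z * poly (map_poly h q) z"
    using arg_cong[OF s(2), of "\<lambda>p. poly (map_poly h p) z"] root by (simp add: map_poly_smult map_poly_mult)
  ultimately have "poly (map_poly h q) z = 0" by simp
  moreover have "q \<noteq> 0" using s f by auto
  ultimately have "Polynomial.degree f \<le> Polynomial.degree q" using minimal by blast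
  moreover have "Polynomial.degree f = Polynomial.degree p + Polynomial.degree q"
    using arg_cong[OF s(2), of Polynomial.degree] s(1) p(2) \<open>q \<noteq> 0\<close> by (simp add: degree_mult_eq)
  ultimately have "Polynomial.degree p = 0" by simp
  then obtain r where "p = [:r:]" by (metis degree_eq_zeroE)
  with p(1) obtain a b where "a * f + b * g = [:r:]" unfolding I_def by fastforce
  with \<open>p = [:r:]\<close> p(2) show thesis by (intro that[of r a b]) auto
qed

text \<open>The valuation at infinity of the rational function field, as a bound on the degree of
  \<open>p\<close> minus that of \<open>q\<close> for some representation \<open>p / q\<close>.
  Stating a bound and not a value lets zero satisfy every \<open>m\<close>.\<close>

definition deg_le :: "int \<Rightarrow> 'a::field poly fract \<Rightarrow> bool" where
  "deg_le m x \<longleftrightarrow> (\<exists>p q. q \<noteq> 0 \<and> x * to_fract q = to_fract p \<and>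
     (p = 0 \<or> int (Polynomial.degree p) \<le> m + int (Polynomial.degree q)))"

lemma deg_le_mono: "deg_le m x \<Longrightarrow> m \<le> m' \<Longrightarrow> deg_le m' x"
  unfolding deg_le_def by (elim exE, intro exI) auto

lemma deg_le_divide:
  assumes "q \<noteq> 0" "int (Polynomial.degree p) \<le> m + int (Polynomial.degree q)"
  shows "deg_le m (to_fract p / to_fract q)"
  unfolding deg_le_def using assms by (intro exI[of _ p] exI[of _ q]) auto

lemma deg_le_to_fract: "int (Polynomial.degree p) \<le> m \<Longrightarrow> deg_le m (to_fract p)"
  using deg_le_divide[of 1 p m] by simp

text \<open>A nonzero polynomial has nonnegative degree; this is what finally contradicts
  arbitrarily small values.\<close>

lemma deg_le_to_fractD:
  assumes "deg_le m (to_fract r)" "r \<noteq> 0"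
  shows "0 \<le> m"
proof -
  from assms(1) obtain p q where "q \<noteq> 0" "to_fract (r * q) = to_fract p"
    and *: "p = 0 \<or> int (Polynomial.degree p) \<le> m + int (Polynomial.degree q)"
    by (auto simp: deg_le_def)
  then have "p = r * q" by (simp only: to_fract_eq_iff)
  with * assms(2) \<open>q \<noteq> 0\<close> show ?thesis by (simp add: degree_mult_eq)
qed

lemma deg_le_mult:
  assumes "deg_le m x" "deg_le m' x'"
  shows "deg_le (m + m') (x * x')"
proof -
  from assms obtain p q p' q' where *: "q \<noteq> 0" "x * to_fract q = to_fract p"
      "q' \<noteq> 0" "x' * to_fract q' = to_fract p'"
    and **: "p = 0 \<or> int (Polynomial.degree p) \<le> m + int (Polynomial.degree q)"
      "p' = 0 \<or> int (Polynomial.degree p') \<le> m' + int (Polynomial.degree q')"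
    by (auto simp: deg_le_def)
  have "q * q' \<noteq> 0" using * by simp
  moreover have "x * x' * to_fract (q * q') = (x * to_fract q) * (x' * to_fract q')"
    by (simp add: algebra_simps)
  then have "x * x' * to_fract (q * q') = to_fract (p * p')" by (simp only: * to_fract_mult)
  moreover have "p * p' = 0 \<or> int (Polynomial.degree (p * p')) \<le> m + m' + int (Polynomial.degree (q * q'))"
    using ** * degree_mult_le[of p p'] by (auto simp: degree_mult_eq)
  ultimately show ?thesis unfolding deg_le_def by blast
qed

lemma deg_le_add:
  assumes "deg_le m x" "deg_le m x'"
  shows "deg_le m (x + x')"
proof -
  from assms obtain p q p' q' where *: "q \<noteq> 0" "x * to_fract q = to_fract p"
      "q' \<noteq> 0" "x' * to_fract q' = to_fract p'"
    and **: "p = 0 \<or> int (Polynomial.degree p) \<le> m + int (Polynomial.degree q)"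
      "p' = 0 \<or> int (Polynomial.degree p') \<le> m + int (Polynomial.degree q')"
    by (auto simp: deg_le_def)
  have "q * q' \<noteq> 0" using * by simp
  moreover have "(x + x') * to_fract (q * q') =
      (x * to_fract q) * to_fract q' + (x' * to_fract q') * to_fract q"
    by (simp add: algebra_simps)
  then have "(x + x') * to_fract (q * q') = to_fract (p * q' + p' * q)"
    by (simp only: * to_fract_mult to_fract_add)
  moreover have "p * q' + p' * q = 0 \<or> int (Polynomial.degree (p * q' + p' * q)) \<le> m + int (Polynomial.degree (q * q'))"
  proof (rule disjCI)
    assume nz: "\<not> int (Polynomial.degree (p * q' + p' * q)) \<le> m + int (Polynomial.degree (q * q'))"
    have 1: "p * q' = 0 \<or> int (Polynomial.degree (p * q')) \<le> m + int (Polynomial.degree (q * q'))"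
      and 2: "p' * q = 0 \<or> int (Polynomial.degree (p' * q)) \<le> m + int (Polynomial.degree (q * q'))"
      using ** * degree_mult_le[of p q'] degree_mult_le[of p' q] by (auto simp: degree_mult_eq)
    show "p * q' + p' * q = 0"
      using 1 2 nz degree_add_le_max[of "p * q'" "p' * q"] by (auto simp: max_def split: if_splits)
  qed
  ultimately show ?thesis unfolding deg_le_def by blast
qed

lemma deg_le_minus: "deg_le m (- x) \<longleftrightarrow> deg_le m x"
proof -
  have *: "deg_le m (- x)" if "deg_le m x" for x :: "'a poly fract"
  proof -
    from that obtain p q where "q \<noteq> 0" "x * to_fract q = to_fract p"
      "p = 0 \<or> int (Polynomial.degree p) \<le> m + int (Polynomial.degree q)"
      by (auto simp: deg_le_def)
    then show ?thesis unfolding deg_le_def by (intro exI[of _ "- p"] exI[of _ q]) auto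
  qed
  show ?thesis using *[of x] *[of "- x"] by auto
qed

lemma deg_le_diff: "deg_le m x \<Longrightarrow> deg_le m x' \<Longrightarrow> deg_le m (x - x')"
  using deg_le_add[of m x "- x'"] by (simp add: deg_le_minus)

lemma deg_le_exists: "\<exists>m\<ge>0. deg_le m x"
proof (cases x)
  case (Fract p q)
  then have x: "x = to_fract p / to_fract q" by (simp add: Fract_conv_to_fract)
  have "deg_le (int (Polynomial.degree p)) x"
    unfolding x by (rule deg_le_divide) (use Fract in auto)
  then show ?thesis by (intro exI[of _ "int (Polynomial.degree p)"]) auto
qed

text \<open>Horner's scheme, by induction. The point is that \<open>C\<close> does not depend on
  \<open>z\<close>, so one bound serves all convergents.\<close>

lemma deg_le_poly: "\<exists>C\<ge>0. \<forall>z. deg_le 0 z \<longrightarrow> deg_le C (poly f z)"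
proof (induction f)
  case 0
  show ?case using deg_le_to_fract[of 0 0] by (intro exI[of _ 0]) auto
next
  case (pCons a f)
  then obtain C where C: "C \<ge> 0" "\<And>z. deg_le 0 z \<Longrightarrow> deg_le C (poly f z)" by auto
  obtain m where m: "m \<ge> 0" "deg_le m a" using deg_le_exists by blast
  have "deg_le (max m C) (a + z * poly f z)" if "deg_le 0 z" for z
    by (intro deg_le_add deg_le_mono[OF m(2)] deg_le_mono[OF deg_le_mult[OF that C(2)[OF that]]]) auto
  with m(1) show ?case by (intro exI[of _ "max m C"]) auto
qed

text \<open>The Taylor remainder of second order is \<open>h * h\<close> times a polynomial in
  \<open>z\<close> and \<open>h\<close>, which is bounded uniformly over arguments of degree at most
  0.\<close>

lemma deg_le_poly_taylor:
  "\<exists>C. \<forall>z h m. deg_le 0 z \<longrightarrow> deg_le m h \<longrightarrow> m \<le> 0 \<longrightarrow>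
     deg_le (C + 2 * m) (poly f (z + h) - poly f z - h * poly (pderiv f) z)"
proof (induction f)
  case 0
  have "deg_le m 0" for m :: int
    unfolding deg_le_def by (intro exI[of _ 0] exI[of _ 1]) simp
  then show ?case by auto
next
  case (pCons a f)
  let ?rem = "\<lambda>f z h. poly f (z + h) - poly f z - h * poly (pderiv f) z"
  obtain C where C: "\<And>z h m. deg_le 0 z \<Longrightarrow> deg_le m h \<Longrightarrow> m \<le> 0 \<Longrightarrow> deg_le (C + 2 * m) (?rem f z h)"
    using pCons.IH by blast
  obtain C' where C': "\<And>z. deg_le 0 z \<Longrightarrow> deg_le C' (poly (pderiv f) z)"
    using deg_le_poly[of "pderiv f"] by blast
  have "deg_le (max C C' + 2 * m) (?rem (pCons a f) z h)" if *: "deg_le 0 z" "deg_le m h" "m \<le> 0" for z h m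
  proof -
    \<comment> \<open>Prepending a coefficient multiplies the remainder by \<open>z + h\<close> and
      adds one term that is already of second order in \<open>h\<close>.\<close>
    have "?rem (pCons a f) z h = (z + h) * ?rem f z h + h * h * poly (pderiv f) z"
      by (simp add: pderiv_pCons algebra_simps)
    moreover have "deg_le 0 (z + h)" 
      using deg_le_mono[OF *(2,3)] *(1) by (intro deg_le_add)
    from deg_le_mult[OF this C[OF *]] have "deg_le (max C C' + 2 * m) ((z + h) * ?rem f z h)"
      by (rule deg_le_mono) simp
    moreover from deg_le_mult[OF deg_le_mult[OF *(2) *(2)] C'[OF *(1)]]
    have "deg_le (max C C' + 2 * m) (h * h * poly (pderiv f) z)" by (rule deg_le_mono) simp
    ultimately show ?thesis by (simp add: deg_le_add)
  qed
  then show ?case by blast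
qed

section \<open>Periodic binary forms\<close>

text \<open>
  The transpose of \<open>pullback\<close>: up to a shift of \<open>t\<close>, a form \<open>F\<close> takes at \<open>dual_step p\<close> the value of
  \<open>pullback d F\<close> at \<open>p\<close>.
\<close>
definition dual_step :: "'a::idom poly \<times> 'a poly \<Rightarrow> 'a poly \<times> 'a poly" where
  "dual_step p = (shift (- 1) (snd p), shift (- 1) (fst p + [:0, 1:] * snd p))"

text \<open>One \<open>pullback\<close> changes the value only by \<open>shift 1\<close>, which
  keeps degrees; so the iteration can be moved from the form to its arguments.\<close>

lemma degree_form_eval_pullback_funpow:
  "Polynomial.degree (form_eval (\<lambda>p. p) d ((pullback d ^^ n) f) (fst p) (snd p)) =
   Polynomial.degree (form_eval (\<lambda>p. p) d f (fst ((dual_step ^^ n) p)) (snd ((dual_step ^^ n) p)))"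
proof (induction n arbitrary: p)
  case (Suc n)
  have step: "form_eval (\<lambda>p. p) d (pullback d g) (fst p) (snd p) =
      shift 1 (form_eval (\<lambda>p. p) d g (fst (dual_step p)) (snd (dual_step p)))" for g
    using form_eval_hom[OF shift.comm_ring_map_axioms, of 1 "\<lambda>p. p" d g
        "fst (dual_step p)" "snd (dual_step p)"]
    by (simp add: form_eval_pullback[OF comm_ring_map_id] dual_step_def)
  have "Polynomial.degree (form_eval (\<lambda>p. p) d ((pullback d ^^ Suc n) f) (fst p) (snd p)) =
      Polynomial.degree (form_eval (\<lambda>p. p) d ((pullback d ^^ n) f) (fst (dual_step p)) (snd (dual_step p)))"
    using step[of "(pullback d ^^ n) f"] by simp
  then show ?case by (simp add: Suc.IH funpow_swap1)
qed simp

text \<open>The factor \<open>t\<close> makes the second component dominate, so its degree grows by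
  exactly one per step; the first component is the former second one, shifted.\<close>

lemma degree_dual_step_funpow:
  assumes "Polynomial.degree (fst p) = 0" "Polynomial.degree (snd p) = 0" "snd p \<noteq> 0"
  shows "snd ((dual_step ^^ n) p) \<noteq> 0 \<and> Polynomial.degree (snd ((dual_step ^^ n) p)) = n \<and>
    Polynomial.degree (fst ((dual_step ^^ n) p)) \<le> n"
proof (induction n)
  case (Suc n)
  define q where "q = (dual_step ^^ n) p"
  have q: "snd q \<noteq> 0" "Polynomial.degree (snd q) = n" "Polynomial.degree (fst q) \<le> n"
    using Suc by (simp_all add: q_def)
  have X: "Polynomial.degree ([:0, 1:] * snd q) = Suc n"
    using q by (subst degree_mult_eq) auto
  then have deg: "Polynomial.degree (fst q + [:0, 1:] * snd q) = Suc n"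
    using q(3) by (subst degree_add_eq_right) auto
  then have "fst q + [:0, 1:] * snd q \<noteq> 0" by (metis Zero_neq_Suc degree_0)
  with q deg show ?case unfolding funpow.simps o_apply q_def[symmetric] by (simp add: dual_step_def)
qed (use assms in simp)

text \<open>The matrix of \<open>dual_step\<close> has determinant -1 and \<open>shift\<close> fixes
  constants. Hence two convergents of equal index differ by a constant over the product of their
  denominators.\<close>

lemma det_dual_step_funpow:
  fixes p q :: "'a::idom poly \<times> 'a poly"
  assumes "fst p * snd q - snd p * fst q = [:e:]"
  shows "fst ((dual_step ^^ n) p) * snd ((dual_step ^^ n) q) -
      snd ((dual_step ^^ n) p) * fst ((dual_step ^^ n) q) = [:(- 1) ^ n * e:]"
proof (induction n)
  case (Suc n)
  have ring: "y * (x' + t * y') - (x + t * y) * y' = - (x * y' - y * x')" for x y x' y' t :: "'a poly"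
    by (simp add: algebra_simps)
  have "fst (dual_step a) * snd (dual_step b) - snd (dual_step a) * fst (dual_step b) =
      - shift (- 1) (fst a * snd b - snd a * fst b)" for a b :: "'a poly \<times> 'a poly"
    unfolding dual_step_def
    by (simp only: fst_conv snd_conv shift.map_add shift.map_mult shift.map_diff ring)
  then show ?case using Suc by simp
qed (use assms in simp)

lemma pullback_periodic_funpow:
  assumes "(pullback d ^^ N) f = smult [:c:] f"
  shows "(pullback d ^^ (k * N)) f = smult [:c ^ k:] f"
proof (induction k)
  case (Suc k)
  have "(pullback d ^^ (Suc k * N)) f = (pullback d ^^ N) ((pullback d ^^ (k * N)) f)"
    by (simp add: funpow_add)
  also have "\<dots> = smult [:c ^ Suc k:] f"
    by (simp only: Suc pullback_funpow_smult assms) (simp add: mult.commute)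
  finally show ?case .
qed (simp flip: one_pCons)

text \<open>
  The values \<open>z\<close>, \<open>z'\<close> are the convergents of index \<open>n\<close> for two choices of initial values. They
  differ by about \<open>t ^ (- 2 n)\<close>, whereas periodicity makes \<open>f z\<close> and \<open>f z'\<close> of order
  \<open>t ^ (- d n)\<close>. For \<open>d \<ge> 3\<close> both \<open>f\<close> and \<open>f'\<close> are small at \<open>z\<close>, against the Bezout identity.
\<close>
lemma periodic_form_degree_le_2:
  fixes f :: "'a::field poly poly"
  assumes deg: "Polynomial.degree f = d" and N: "N > 0"
    and per: "(pullback d ^^ N) f = smult [:c:] f"
    and bez: "a * f + b * pderiv f = [:r:]" "r \<noteq> 0"
  shows "d \<le> 2"
proof (rule ccontr)
  assume "\<not> d \<le> 2"
  interpret fr: comm_ring_map "to_fract :: 'a poly \<Rightarrow> 'a poly fract"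
    by (rule comm_ring_map_to_fract)
  define F where "F = map_poly to_fract f"
  \<comment> \<open>Two orbits with constant initial vectors of determinant -1; their ratios are the
    convergents \<open>z\<close> and \<open>z'\<close>.\<close>
  define P :: "nat \<Rightarrow> 'a poly \<times> 'a poly" where "P n = (dual_step ^^ n) (0, 1)" for n
  define Q :: "nat \<Rightarrow> 'a poly \<times> 'a poly" where "Q n = (dual_step ^^ n) (1, 1)" for n
  define z where "z n = to_fract (fst (P n)) / to_fract (snd (P n))" for n
  define z' where "z' n = to_fract (fst (Q n)) / to_fract (snd (Q n))" for n
  have P: "snd (P n) \<noteq> 0" "Polynomial.degree (snd (P n)) = n" "Polynomial.degree (fst (P n)) \<le> n" for n
    using degree_dual_step_funpow[of "(0, 1) :: 'a poly \<times> 'a poly" n] by (simp_all add: P_def)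
  have Q: "snd (Q n) \<noteq> 0" "Polynomial.degree (snd (Q n)) = n" "Polynomial.degree (fst (Q n)) \<le> n" for n
    using degree_dual_step_funpow[of "(1, 1) :: 'a poly \<times> 'a poly" n] by (simp_all add: Q_def)
  have det: "fst (P n) * snd (Q n) - snd (P n) * fst (Q n) = [:(- 1) ^ n * - 1:]" for n
    unfolding P_def Q_def by (rule det_dual_step_funpow) (simp add: one_pCons)
  have z: "deg_le 0 (z n)" and z': "deg_le 0 (z' n)" for n
    unfolding z_def z'_def by (auto intro!: deg_le_divide simp: P Q)
  define w where "w n = to_fract (snd (P n) * snd (Q n))" for n
  have w0: "w n \<noteq> 0" for n using P Q by (simp add: w_def)
  have w: "deg_le (2 * int n) (w n)" for n
    unfolding w_def by (rule deg_le_to_fract) (simp add: P Q degree_mult_eq)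
  have diff: "z' n - z n = to_fract [:(- 1) ^ n:] / w n" for n
  proof -
    have "(z' n - z n) * w n = to_fract (- (fst (P n) * snd (Q n) - snd (P n) * fst (Q n)))"
      using P(1)[of n] Q(1)[of n] by (simp add: z_def z'_def w_def field_simps)
    also have "\<dots> = to_fract [:(- 1) ^ n:]" unfolding det by simp
    finally show ?thesis using w0[of n] by (simp add: eq_divide_eq)
  qed
  have small_diff: "deg_le (- 2 * int n) (z' n - z n)" for n
    unfolding diff w_def by (rule deg_le_divide) (simp_all add: P Q degree_mult_eq)
  \<comment> \<open>By periodicity the degree of the form at an index \<open>k * N\<close> is at
    most its degree at the initial vector; \<open>D\<close> bounds this for both orbits.\<close>
  define D where "D = max (Polynomial.degree (form_eval (\<lambda>p. p) d f 0 1))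
      (Polynomial.degree (form_eval (\<lambda>p. p) d f 1 1))"
  have small: "deg_le (int D - int (d * n)) (poly F (to_fract x / to_fract y))"
    if n: "n = k * N" and xy: "(x, y) = (dual_step ^^ n) (x0, 1)" "x0 = 0 \<or> x0 = 1"
      "y \<noteq> 0" "Polynomial.degree y = n" for x y x0 n k
  proof -
    have "Polynomial.degree (form_eval (\<lambda>p. p) d f x y) =
        Polynomial.degree (form_eval (\<lambda>p. p) d (smult [:c ^ k:] f) x0 1)"
      using degree_form_eval_pullback_funpow[of d n f "(x0, 1)"] pullback_periodic_funpow[OF per, of k]
      unfolding xy(1)[symmetric] n[symmetric] by simp
    also have "\<dots> \<le> Polynomial.degree (form_eval (\<lambda>p. p) d f x0 1)"
      by (simp add: comm_ring_map.form_eval_smult[OF comm_ring_map_id])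
    also have "\<dots> \<le> D" using xy(2) by (auto simp: D_def)
    finally have le: "Polynomial.degree (form_eval (\<lambda>p. p) d f x y) \<le> D" .
    have "to_fract (form_eval (\<lambda>p. p) d f x y) = form_eval to_fract d f (to_fract x) (to_fract y)"
      using form_eval_hom[OF comm_ring_map_to_fract, of "\<lambda>p. p" d f x y] by simp
    also have "\<dots> = to_fract (y ^ d) * poly F (to_fract x / to_fract y)"
      unfolding F_def using deg xy(3)
      by (subst form_eval_eq_poly[OF comm_ring_map_to_fract]) (simp_all add: fr.map_power)
    finally have "poly F (to_fract x / to_fract y) = to_fract (form_eval (\<lambda>p. p) d f x y) / to_fract (y ^ d)"
      using xy(3) by (simp add: field_simps fr.map_power)
    moreover have "deg_le (int D - int (d * n)) (to_fract (form_eval (\<lambda>p. p) d f x y) / to_fract (y ^ d))"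
      by (rule deg_le_divide) (use le xy in \<open>simp_all add: degree_power_eq\<close>)
    ultimately show ?thesis by simp
  qed
  have Fz: "deg_le (int D - int (d * (k * N))) (poly F (z (k * N)))" for k
    unfolding z_def by (rule small[of _ k "fst (P (k * N))" "snd (P (k * N))" 0]) (use P in \<open>simp_all add: P_def\<close>)
  have Fz': "deg_le (int D - int (d * (k * N))) (poly F (z' (k * N)))" for k
    unfolding z'_def by (rule small[of _ k "fst (Q (k * N))" "snd (Q (k * N))" 1]) (use Q in \<open>simp_all add: Q_def\<close>)
  obtain C where C: "\<And>z h m. deg_le 0 z \<Longrightarrow> deg_le m h \<Longrightarrow> m \<le> 0 \<Longrightarrow>
      deg_le (C + 2 * m) (poly F (z + h) - poly F z - h * poly (pderiv F) z)"
    using deg_le_poly_taylor[of F] by blast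
  obtain CA where CA: "CA \<ge> 0" "\<And>z. deg_le 0 z \<Longrightarrow> deg_le CA (poly (map_poly to_fract a) z)"
    using deg_le_poly by blast
  obtain CB where CB: "CB \<ge> 0" "\<And>z. deg_le 0 z \<Longrightarrow> deg_le CB (poly (map_poly to_fract b) z)"
    using deg_le_poly by blast
  define M where "M = max (int D) C"
  \<comment> \<open>A multiple of the period, so that the bounds on \<open>F\<close> apply, and
    large enough to make \<open>CA + CB + M - n\<close> negative.\<close>
  define n where "n = nat (CA + CB + M + 1) * N"
  have n: "int n > CA + CB + M"
  proof -
    have "nat (CA + CB + M + 1) * 1 \<le> n" unfolding n_def using N by (intro mult_le_mono) auto
    then show ?thesis by linarith
  qed
  \<comment> \<open>Here \<open>d \<ge> 3\<close> enters: the order \<open>d * n\<close> exceeds the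
    degree \<open>2 * n\<close> of the denominator of \<open>h\<close> by at least
    \<open>n\<close>.\<close>
  have dn: "int D - int (d * n) \<le> M - 3 * int n"
  proof -
    have "3 * n \<le> d * n" using \<open>\<not> d \<le> 2\<close> by (intro mult_le_mono) auto
    then have "3 * int n \<le> int (d * n)" by linarith
    then show ?thesis by (simp add: M_def)
  qed
  have F1: "deg_le (M - 3 * int n) (poly F (z n))" "deg_le (M - 3 * int n) (poly F (z' n))"
    using deg_le_mono[OF Fz dn[unfolded n_def]] deg_le_mono[OF Fz' dn[unfolded n_def]] by (simp_all add: n_def)
  define h where "h = z' n - z n"
  have zh: "z n + h = z' n" by (simp add: h_def)
  have "deg_le (C + 2 * (- 2 * int n)) (poly F (z' n) - poly F (z n) - h * poly (pderiv F) (z n))"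
    using C[OF z[of n] small_diff[of n]] unfolding h_def[symmetric] zh by simp
  then have "deg_le (M - 3 * int n) (poly F (z' n) - poly F (z n) - h * poly (pderiv F) (z n))"
    by (rule deg_le_mono) (simp add: M_def)
  \<comment> \<open>The two values of \<open>F\<close> and the remainder share the bound
    \<open>M - 3 * n\<close>, so the linear Taylor term inherits it.\<close>
  from deg_le_diff[OF deg_le_diff[OF F1(2,1)] this]
  have "deg_le (M - 3 * int n) (h * poly (pderiv F) (z n))" by simp
  \<comment> \<open>Multiplying by the denominator \<open>w n\<close> of \<open>h\<close>, of degree
    \<open>2 * n\<close>, leaves the derivative up to sign, with the bound
    \<open>M - n\<close>.\<close>
  from deg_le_mult[OF this w[of n]]
  have "deg_le (M - int n) (h * poly (pderiv F) (z n) * w n)" by simp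
  moreover have "h * w n = to_fract [:(- 1) ^ n:]" using w0 by (simp add: h_def diff)
  then have "h * poly (pderiv F) (z n) * w n = to_fract [:(- 1) ^ n:] * poly (pderiv F) (z n)"
    by (metis mult.assoc mult.commute)
  ultimately have "deg_le (M - int n) (to_fract [:(- 1) ^ n:] * poly (pderiv F) (z n))" by simp
  moreover have "deg_le 0 (to_fract [:(- 1) ^ n:] :: 'a poly fract)" by (rule deg_le_to_fract) simp
  ultimately have "deg_le (0 + (M - int n))
      (to_fract [:(- 1) ^ n:] * (to_fract [:(- 1) ^ n:] * poly (pderiv F) (z n)))"
    by (intro deg_le_mult)
  moreover have "to_fract [:(- 1) ^ n:] * (to_fract [:(- 1) ^ n:] * x) = x" for x :: "'a poly fract"
  proof -
    have eq: "[:(- 1) ^ n:] * [:(- 1) ^ n :: 'a:] = 1" by (simp flip: power_mult_distrib add: one_pCons)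
    then have "to_fract [:(- 1) ^ n:] * to_fract [:(- 1) ^ n :: 'a:] = 1"
      unfolding to_fract_mult[symmetric] eq by simp
    then show ?thesis by (metis mult.assoc mult_1)
  qed
  ultimately have F2: "deg_le (M - int n) (poly (pderiv F) (z n))" by simp
  \<comment> \<open>Evaluated at \<open>z n\<close>, the Bezout identity now bounds the nonzero
    polynomial \<open>r\<close> by a negative degree.\<close>
  have "to_fract r = poly (map_poly to_fract (a * f + b * pderiv f)) (z n)"
    unfolding bez(1) by (simp add: fr.map_poly_const)
  also have "\<dots> = poly (map_poly to_fract a) (z n) * poly F (z n) + poly (map_poly to_fract b) (z n) * poly (pderiv F) (z n)"
    by (simp add: fr.map_poly_add fr.map_poly_mult map_poly_pderiv[OF comm_ring_map_to_fract] F_def)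
  finally have r_eq: "to_fract r = \<dots>" .
  have "deg_le (CA + CB + M - int n) (poly (map_poly to_fract a) (z n) * poly F (z n))"
    by (rule deg_le_mono[OF deg_le_mult[OF CA(2)[OF z] F1(1)]]) (use CB(1) n in simp)
  moreover have "deg_le (CA + CB + M - int n) (poly (map_poly to_fract b) (z n) * poly (pderiv F) (z n))"
    by (rule deg_le_mono[OF deg_le_mult[OF CB(2)[OF z] F2]]) (use CA(1) in simp)
  ultimately have "deg_le (CA + CB + M - int n) (to_fract r)" unfolding r_eq by (rule deg_le_add)
  from deg_le_to_fractD[OF this bez(2)] n show False by simp
qed

section \<open>Periodic forms of degree two and one\<close>

lemma pullback_2:
  fixes f :: "'a::idom poly poly"
  shows "pullback 2 f = [: [:0, 1:]\<^sup>2 * shift 1 (Polynomial.coeff f 0) + [:0, 1:] * shift 1 (Polynomial.coeff f 1)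
      + shift 1 (Polynomial.coeff f 2), 2 * [:0, 1:] * shift 1 (Polynomial.coeff f 0) + shift 1 (Polynomial.coeff f 1),
      shift 1 (Polynomial.coeff f 0) :]"
proof -
  define t :: "'a poly" where "t = [:0, 1:]"
  have "[:t, 1:]\<^sup>2 = [:t\<^sup>2, 2 * t, 1:]"
    by (simp add: power2_eq_square)
  then show ?thesis
    unfolding pullback_def t_def[symmetric] by (simp add: numeral_2_eq_2 atMost_Suc algebra_simps)
qed

lemma pullback_1:
  "pullback 1 f = [: [:0, 1:] * shift 1 (Polynomial.coeff f 0) + shift 1 (Polynomial.coeff f 1),
      shift 1 (Polynomial.coeff f 0) :]"
  unfolding pullback_def by (simp add: atMost_Suc algebra_simps)

definition quadratic_disc :: "'a::comm_ring_1 poly \<Rightarrow> 'a" where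
  "quadratic_disc f = (Polynomial.coeff f 1)\<^sup>2 - 4 * Polynomial.coeff f 0 * Polynomial.coeff f 2"

text \<open>A substitution multiplies the discriminant by the square of its determinant, here -1, so
  only the shift of the coefficients remains.\<close>

lemma quadratic_disc_pullback: "quadratic_disc (pullback 2 f) = shift 1 (quadratic_disc f)"
proof -
  define a b c where "a = shift 1 (Polynomial.coeff f 0)" "b = shift 1 (Polynomial.coeff f 1)"
    "c = shift 1 (Polynomial.coeff f 2)"
  define t :: "'a poly" where "t = [:0, 1:]"
  have "quadratic_disc (pullback 2 f) = (2 * t * a + b)\<^sup>2 - 4 * (t\<^sup>2 * a + t * b + c) * a"
    unfolding quadratic_disc_def pullback_2 a_b_c_def[symmetric] t_def[symmetric]
    by (simp add: numeral_2_eq_2)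
  also have "\<dots> = b\<^sup>2 - 4 * a * c" by (simp add: power2_eq_square algebra_simps)
  also have "\<dots> = shift 1 (quadratic_disc f)"
  proof -
    have "shift 1 (4 :: 'a poly) = 4" using shift.map_of_nat[of 1 4] by simp
    then show ?thesis
      by (simp add: quadratic_disc_def a_b_c_def shift.map_diff shift.map_mult shift.map_power)
  qed
  finally show ?thesis .
qed

lemma quadratic_disc_pullback_funpow:
  "quadratic_disc ((pullback 2 ^^ n) f) = shift (of_nat n) (quadratic_disc f)"
  by (induction n) (auto simp: quadratic_disc_pullback)

text \<open>\<open>p\<close> takes the value \<open>poly p 0\<close> at all natural multiples of
  \<open>N\<close>, which are infinitely many in characteristic zero.\<close>

lemma shift_periodic_imp_const:
  fixes p :: "'a::field_char_0 poly"
  assumes "shift (of_nat N) p = p" "N > 0"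
  shows "p = [:poly p 0:]"
proof -
  have step: "poly p (of_nat N + x) = poly p x" for x using assms(1) by (metis poly_shift)
  have "poly p (of_nat (k * N)) = poly p 0" for k
  proof (induction k)
    case (Suc k)
    then show ?case using step[of "of_nat (k * N)"] by simp
  qed simp
  then have "range (\<lambda>k. of_nat (k * N)) \<subseteq> {x. poly (p - [:poly p 0:]) x = 0}" by auto
  moreover have "infinite (range (\<lambda>k. of_nat (k * N) :: 'a))"
    by (rule range_inj_infinite) (use assms(2) in \<open>auto simp: inj_def simp del: of_nat_mult\<close>)
  ultimately have "p - [:poly p 0:] = 0" by (metis poly_roots_finite finite_subset)
  then show ?thesis by simp
qed

text \<open>The multiplier \<open>c\<close> scales the discriminant by \<open>c ^ 2\<close>, whereas
  a shift keeps the leading coefficient. So \<open>c ^ 2 = 1\<close> unless the discriminant is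
  zero, and the discriminant is periodic.\<close>

lemma quadratic_disc_periodic:
  fixes f :: "'a::field_char_0 poly poly"
  assumes N: "N > 0" and per: "(pullback 2 ^^ N) f = smult [:c:] f"
  obtains e where "quadratic_disc f = [:e:]"
proof (cases "quadratic_disc f = 0")
  case False
  have eq: "shift (of_nat N) (quadratic_disc f) = smult (c\<^sup>2) (quadratic_disc f)"
    using quadratic_disc_pullback_funpow[of N f, symmetric]
    by (simp add: per) (simp add: quadratic_disc_def power2_eq_square smult_diff_right)
  have "lead_coeff (quadratic_disc f) = c\<^sup>2 * lead_coeff (quadratic_disc f)"
    using arg_cong[OF eq, of lead_coeff] by (simp only: lead_coeff_shift lead_coeff_smult)
  with False have "c\<^sup>2 = 1" by simp
  with eq have "shift (of_nat N) (quadratic_disc f) = quadratic_disc f" by simp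
  from shift_periodic_imp_const[OF this N] that show thesis by blast
qed (use that[of 0] in simp)

text \<open>Let \<open>a\<close> be the coefficient of \<open>Y\<close> and \<open>b\<close> that of
  \<open>X\<close>. Up to shifts, a step replaces \<open>a\<close> by \<open>t * a + b\<close> and
  \<open>b\<close> by \<open>a\<close>. Once \<open>a\<close> has at least the degree of
  \<open>b\<close>, its degree grows at every step, against the period; otherwise the degree of
  \<open>b\<close> falls at every step.\<close>

lemma periodic_linear_form_eq_0:
  fixes f :: "'a::field poly poly"
  assumes N: "N > 0" and deg: "Polynomial.degree f \<le> 1"
    and per: "(pullback 1 ^^ N) f = smult [:c:] f" and c: "c \<noteq> 0"
  shows "f = 0"
proof (rule ccontr)
  assume "f \<noteq> 0"
  define a where "a n = Polynomial.coeff ((pullback 1 ^^ n) f) 0" for n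
  define b where "b n = Polynomial.coeff ((pullback 1 ^^ n) f) 1" for n
  have a_Suc: "a (Suc n) = [:0, 1:] * shift 1 (a n) + shift 1 (b n)" and b_Suc: "b (Suc n) = shift 1 (a n)" for n
    unfolding a_def b_def by (simp_all only: funpow.simps o_apply pullback_1) simp_all
  have per': "a (n + N) = smult c (a n)" for n
  proof -
    have "(pullback 1 ^^ (n + N)) f = smult [:c:] ((pullback 1 ^^ n) f)"
      by (simp only: funpow_add o_apply per pullback_funpow_smult)
    then show ?thesis by (simp add: a_def)
  qed
  have nz: "a n \<noteq> 0 \<or> b n \<noteq> 0" for n
  proof (induction n)
    case 0
    show ?case
    proof (rule ccontr)
      assume "\<not> ?thesis"
      then have "Polynomial.coeff f i = 0" for i
        using deg by (cases "i \<le> 1") (auto simp: a_def b_def le_Suc_eq coeff_eq_0)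
      then show False using \<open>f \<noteq> 0\<close> by (auto simp: poly_eq_iff)
    qed
  qed (auto simp: a_Suc b_Suc)
  have grow: "a (Suc n) \<noteq> 0 \<and> Polynomial.degree (b (Suc n)) \<le> Polynomial.degree (a (Suc n)) \<and>
      Polynomial.degree (a (Suc n)) = Suc (Polynomial.degree (a n))"
    if "a n \<noteq> 0" "Polynomial.degree (b n) \<le> Polynomial.degree (a n)" for n
  proof -
    have "Polynomial.degree ([:0, 1:] * shift 1 (a n)) = Suc (Polynomial.degree (a n))"
      using that by (subst degree_mult_eq) auto
    then have "Polynomial.degree (a (Suc n)) = Suc (Polynomial.degree (a n))"
      unfolding a_Suc using that by (subst degree_add_eq_left) auto
    moreover from this have "a (Suc n) \<noteq> 0" by (metis Zero_neq_Suc degree_0)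
    ultimately show ?thesis by (simp add: b_Suc)
  qed
  have not_good: "a n = 0 \<or> Polynomial.degree (a n) < Polynomial.degree (b n)" for n
  proof (rule ccontr)
    assume *: "\<not> ?thesis"
    have "a (n + k) \<noteq> 0 \<and> Polynomial.degree (b (n + k)) \<le> Polynomial.degree (a (n + k)) \<and>
        Polynomial.degree (a (n + k)) = Polynomial.degree (a n) + k" for k
    proof (induction k)
      case (Suc k)
      then show ?case using grow[of "n + k"] by simp
    qed (use * in auto)
    from this[of N] show False using N c by (simp add: per')
  qed
  \<comment> \<open>If \<open>a n = 0\<close>, then \<open>b (Suc n) = 0\<close> and
    \<open>a (Suc n)\<close> is a shift of \<open>b n\<close>, which is nonzero: just what
    \<open>not_good\<close> excludes.\<close>
  have a_nz: "a n \<noteq> 0" for n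
    using not_good[of "Suc n"] nz[of n] by (auto simp: a_Suc b_Suc)
  have "Polynomial.degree (b n) + n \<le> Polynomial.degree (b 0)" for n
  proof (induction n)
    case (Suc n)
    then show ?case using not_good[of n] a_nz[of n] by (simp add: b_Suc)
  qed simp
  from this[of "Suc (Polynomial.degree (b 0))"] show False by simp
qed

section \<open>Absence of periodic points\<close>

definition emb :: "complex poly \<Rightarrow> K" where
  "emb p = to_ac (to_fract p)"

interpretation emb: comm_ring_map emb
  by unfold_locales (simp_all add: emb_def)

lemma emb_eq_0_iff [simp]: "emb p = 0 \<longleftrightarrow> p = 0"
  by (simp add: emb_def)

text \<open>\<open>K\<close> is algebraic over the rational functions, and clearing denominators
  moves the coefficients into the polynomial ring.\<close>

lemma ex_root_poly_emb:
  obtains f where "f \<noteq> 0" "poly (map_poly emb f) z = 0"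
proof -
  obtain p :: "complex poly fract poly" where p: "p \<noteq> 0" "poly (map_poly to_ac p) z = 0"
    by (rule alg_closure_algebraic)
  obtain c f where cf: "p = smult c (map_poly to_fract f)" "content f = 1"
    by (rule content_decompose_fract)
  have "map_poly to_ac p = smult (to_ac c) (map_poly emb f)"
    unfolding cf(1) by (rule poly_eqI) (simp add: coeff_map_poly emb_def)
  then have "poly (map_poly emb f) z = 0" using p cf by auto
  with cf(2) show thesis by (intro that[of f]) auto
qed

text \<open>Dividing a polynomial of least degree by its content keeps the root and the degree.
  Primitivity is recorded as the absence of a number at which all coefficients vanish.\<close>

lemma ex_minimal_primitive_root:
  obtains f where "f \<noteq> 0" "poly (map_poly emb f) z = 0"
    "\<And>g. g \<noteq> 0 \<Longrightarrow> poly (map_poly emb g) z = 0 \<Longrightarrow> Polynomial.degree f \<le> Polynomial.degree g"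
    "\<And>\<alpha>. \<exists>j. poly (Polynomial.coeff f j) \<alpha> \<noteq> 0"
proof -
  obtain f0 where f0: "f0 \<noteq> 0" "poly (map_poly emb f0) z = 0"
    and min: "\<And>g. g \<noteq> 0 \<Longrightarrow> poly (map_poly emb g) z = 0 \<Longrightarrow> Polynomial.degree f0 \<le> Polynomial.degree g"
    using ex_root_poly_emb[of z]
      ex_has_least_nat[of "\<lambda>f. f \<noteq> 0 \<and> poly (map_poly emb f) z = 0" _ Polynomial.degree] by metis
  define f where "f = primitive_part f0"
  have "f0 = smult (content f0) f" by (simp add: f_def)
  then have "emb (content f0) * poly (map_poly emb f) z = 0"
    using f0(2) emb.map_poly_smult[of "content f0" f] by simp
  with f0(1) have root: "poly (map_poly emb f) z = 0" by simp
  have "\<exists>j. poly (Polynomial.coeff f j) \<alpha> \<noteq> 0" for \<alpha>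
  proof (rule ccontr)
    assume "\<not> ?thesis"
    then have "[:- \<alpha>, 1:] dvd Polynomial.coeff f j" for j by (simp add: poly_eq_0_iff_dvd)
    then have "[:[:- \<alpha>, 1:]:] dvd f" by (simp add: const_poly_dvd_iff)
    then have "[:- \<alpha>, 1:] dvd content f" by (simp add: const_poly_dvd_iff_dvd_content)
    then have "[:- \<alpha>, 1:] dvd 1" using f0(1) by (simp add: f_def)
    then show False by (simp add: is_unit_iff_degree)
  qed
  then show thesis
    by (intro that[of f]) (use f0 root min in \<open>auto simp: f_def\<close>)
qed

section \<open>The field automorphism acting on forms and vectors\<close>

locale shift_automorphism =
  fixes \<sigma> :: "K \<Rightarrow> K"
  assumes aut: "field_automorphism \<sigma>"
    and fixes_const: "\<And>c. \<sigma> (const_K c) = const_K c"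
    and sends_t: "\<sigma> t_K = t_K + 1"
begin

sublocale \<sigma>: comm_ring_map \<sigma>
  using aut by unfold_locales (auto simp: field_automorphism_def)

definition \<tau> :: "K \<Rightarrow> K" where "\<tau> = inv_into UNIV \<sigma>"

lemma \<sigma>_\<tau> [simp]: "\<sigma> (\<tau> x) = x" and \<tau>_\<sigma> [simp]: "\<tau> (\<sigma> x) = x"
  using aut by (auto simp: field_automorphism_def \<tau>_def bij_is_surj surj_f_inv_f bij_is_inj inv_f_f)

sublocale \<tau>: comm_ring_map \<tau>
proof
  show "\<tau> (x + y) = \<tau> x + \<tau> y" for x y by (metis \<sigma>_\<tau> \<tau>_\<sigma> \<sigma>.map_add)
  show "\<tau> (x * y) = \<tau> x * \<tau> y" for x y by (metis \<sigma>_\<tau> \<tau>_\<sigma> \<sigma>.map_mult)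
  show "\<tau> 1 = 1" by (metis \<tau>_\<sigma> \<sigma>.map_one)
qed

lemma \<sigma>_eq_0_iff [simp]: "\<sigma> x = 0 \<longleftrightarrow> x = 0"
  by (metis \<tau>_\<sigma> \<sigma>.map_zero)

lemma \<tau>_eq_0_iff [simp]: "\<tau> x = 0 \<longleftrightarrow> x = 0"
  by (metis \<sigma>_\<tau> \<tau>.map_zero)

text \<open>Both sides are ring homomorphisms in \<open>p\<close> that agree on constants and on
  \<open>t\<close>.\<close>

lemma \<sigma>_emb: "\<sigma> (emb p) = emb (shift 1 p)"
proof (induction p)
  case 0
  then show ?case by (simp add: emb.map_zero \<sigma>.map_zero)
next
  case (pCons a p)
  have *: "pCons a p = [:a:] + [:0, 1:] * p" by simp
  have X: "\<sigma> (emb [:0, 1:]) = emb (shift 1 [:0, 1:])"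
  proof -
    have "emb [:1, 1:] = emb ([:0, 1:] + 1)" by (simp add: one_pCons)
    also have "\<dots> = t_K + 1" by (simp only: emb.map_add emb.map_one) (simp add: emb_def t_K_def)
    finally show ?thesis using sends_t by (simp add: emb_def t_K_def)
  qed
  have c: "\<sigma> (emb [:a:]) = emb (shift 1 [:a:])" using fixes_const[of a] by (simp add: emb_def const_K_def)
  show ?case
    unfolding * shift.map_add shift.map_mult emb.map_add emb.map_mult \<sigma>.map_add \<sigma>.map_mult X c pCons.IH ..
qed

text \<open>The semilinear map of \<open>K\<^sup>2\<close> inducing \<open>\<sigma>\<inverse> \<circ> \<phi>\<close> on points.\<close>
definition step :: "K \<times> K \<Rightarrow> K \<times> K" where
  "step v = (\<tau> (snd v), \<tau> (fst v + t_K * snd v))"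

lemma form_eval_pullback_step:
  "form_eval emb d (pullback d f) (fst v) (snd v) = \<sigma> (form_eval emb d f (fst (step v)) (snd (step v)))"
proof -
  have "emb [:0, 1:] = t_K" by (simp add: emb_def t_K_def)
  then show ?thesis
    using form_eval_hom[OF \<sigma>.comm_ring_map_axioms, of emb d f "fst (step v)" "snd (step v)"]
    by (simp add: form_eval_pullback[OF emb.comm_ring_map_axioms] \<sigma>_emb step_def)
qed

text \<open>Each step costs one application of \<open>\<sigma>\<close>, which has trivial kernel, so
  the vanishing of the value is not affected.\<close>

lemma form_eval_pullback_step_funpow:
  "form_eval emb d ((pullback d ^^ n) f) (fst v) (snd v) = 0 \<longleftrightarrow>
   form_eval emb d f (fst ((step ^^ n) v)) (snd ((step ^^ n) v)) = 0"
proof (induction n arbitrary: v)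
  case (Suc n)
  have "(step ^^ Suc n) v = (step ^^ n) (step v)" by (simp only: funpow_Suc_right o_apply)
  with Suc show ?case by (simp add: form_eval_pullback_step)
qed simp

text \<open>The pullback \<open>g\<close> over one period also vanishes at \<open>x / y\<close>.
  Cancelling the terms of degree \<open>d\<close> in \<open>f\<close> and \<open>g\<close> gives a
  smaller degree, hence zero by minimality, so \<open>g\<close> is a fraction times
  \<open>f\<close>. Primitivity of \<open>f\<close> and invertibility of the substitutions show that
  numerator and denominator have no roots.\<close>

lemma minimal_form_periodic:
  assumes N: "N > 0" and y: "y \<noteq> 0" and per: "(step ^^ N) (x, y) = (\<mu> * x, \<mu> * y)"
    and f: "f \<noteq> 0" "poly (map_poly emb f) (x / y) = 0"
    and minimal: "\<And>g. g \<noteq> 0 \<Longrightarrow> poly (map_poly emb g) (x / y) = 0 \<Longrightarrow> Polynomial.degree f \<le> Polynomial.degree g"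
    and primitive: "\<And>\<alpha>. \<exists>j. poly (Polynomial.coeff f j) \<alpha> \<noteq> 0"
    and d: "d = Polynomial.degree f"
  obtains c where "c \<noteq> 0" "(pullback d ^^ N) f = smult [:c:] f"
proof -
  define g where "g = (pullback d ^^ N) f"
  have deg_g: "Polynomial.degree g \<le> d" unfolding g_def by (rule degree_pullback_funpow) (simp add: d)
  have "form_eval emb d f x y = 0"
    using f(2) y d by (simp add: form_eval_eq_poly[OF emb.comm_ring_map_axioms])
  then have "form_eval emb d g x y = 0"
    using form_eval_pullback_step_funpow[of d N f "(x, y)"]
    by (simp add: per g_def emb.form_eval_scale)
  then have root_g: "poly (map_poly emb g) (x / y) = 0"
    using y deg_g by (simp add: form_eval_eq_poly[OF emb.comm_ring_map_axioms])
  define a where "a = lead_coeff f"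
  define b where "b = Polynomial.coeff g d"
  have "a \<noteq> 0" using f by (simp add: a_def)
  have eq: "smult a g = smult b f"
  proof (rule ccontr)
    define k where "k = smult a g - smult b f"
    assume "smult a g \<noteq> smult b f"
    then have "k \<noteq> 0" by (simp add: k_def)
    have "Polynomial.degree k \<le> d"
      unfolding k_def using deg_g d
      by (intro degree_diff_le order.trans[OF degree_smult_le]) auto
    moreover have "Polynomial.coeff k d = 0" by (simp add: k_def a_def b_def d mult.commute)
    ultimately have "Polynomial.degree k < d" using \<open>k \<noteq> 0\<close> by (metis leading_coeff_0_iff le_neq_implies_less)
    moreover have "map_poly emb k = smult (emb a) (map_poly emb g) - smult (emb b) (map_poly emb f)"
      by (rule poly_eqI) (simp add: k_def coeff_map_poly emb.map_zero emb.map_diff emb.map_mult)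
    then have "poly (map_poly emb k) (x / y) = 0" using root_g f by simp
    ultimately show False using minimal[OF \<open>k \<noteq> 0\<close>] d by simp
  qed
  obtain a' b' where ab: "a = gcd a b * a'" "b = gcd a b * b'" "coprime a' b'"
    using gcd_coprime_exists[of a b] \<open>a \<noteq> 0\<close> by (auto simp: mult.commute)
  have eq': "smult a' g = smult b' f"
  proof -
    have "smult (gcd a b) (smult a' g) = smult (gcd a b) (smult b' f)"
      using eq ab(1,2) by (metis smult_smult)
    then have "smult (gcd a b) (smult a' g - smult b' f) = 0" by (simp add: smult_diff_right)
    with \<open>a \<noteq> 0\<close> show ?thesis by simp
  qed
  have no_common_root: "poly a' \<alpha> \<noteq> 0 \<or> poly b' \<alpha> \<noteq> 0" for \<alpha>
  proof (rule ccontr)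
    assume "\<not> ?thesis"
    then have "[:- \<alpha>, 1:] dvd a'" "[:- \<alpha>, 1:] dvd b'" by (simp_all add: poly_eq_0_iff_dvd)
    then have "[:- \<alpha>, 1:] dvd 1" using ab(3) coprime_common_divisor by blast
    then show False by (simp add: is_unit_iff_degree)
  qed
  have coeff_eq: "poly a' \<alpha> * poly (Polynomial.coeff g j) \<alpha> = poly b' \<alpha> * poly (Polynomial.coeff f j) \<alpha>" for \<alpha> j
    using arg_cong[OF eq', of "\<lambda>p. poly (Polynomial.coeff p j) \<alpha>"] by simp
  \<comment> \<open>A root of \<open>a'\<close> is no root of \<open>b'\<close>, so all coefficients
    of \<open>f\<close> would vanish there.\<close>
  have a'_nz: "poly a' \<alpha> \<noteq> 0" for \<alpha>
    using primitive[of \<alpha>] coeff_eq[of \<alpha>] no_common_root[of \<alpha>] by auto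
  \<comment> \<open>A root \<open>\<alpha>\<close> of \<open>b'\<close> kills every coefficient of
    \<open>g\<close>, so all coefficients of \<open>f\<close> would vanish at
    \<open>N + \<alpha>\<close>.\<close>
  have b'_nz: "poly b' \<alpha> \<noteq> 0" for \<alpha>
  proof
    assume "poly b' \<alpha> = 0"
    then have "poly (Polynomial.coeff g j) \<alpha> = 0" for j using coeff_eq[of \<alpha> j] a'_nz[of \<alpha>] by simp
    then have "poly (Polynomial.coeff f j) (of_nat N + \<alpha>) = 0" for j
      unfolding g_def by (intro coeffs_vanish_pullback_funpow[of f d N \<alpha>]) (auto simp: d)
    with primitive[of "of_nat N + \<alpha>"] show False by blast
  qed
  have const: "\<exists>c. c \<noteq> 0 \<and> p = [:c:]" if "\<And>\<alpha>. poly p \<alpha> \<noteq> 0" for p :: "complex poly"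
  proof -
    have "constant (poly p)" using fundamental_theorem_of_algebra[of p] that by blast
    then have "Polynomial.degree p = 0" by (simp add: constant_degree)
    then obtain c where "p = [:c:]" by (metis degree_eq_zeroE)
    with that[of 0] show ?thesis by auto
  qed
  obtain c1 c2 where c: "c1 \<noteq> 0" "a' = [:c1:]" "c2 \<noteq> 0" "b' = [:c2:]"
    using const[of a'] const[of b'] a'_nz b'_nz by metis
  have "g = smult [:inverse c1:] (smult a' g)" using c by (simp flip: one_pCons)
  also have "\<dots> = smult [:c2 / c1:] f" unfolding eq' using c by (simp add: divide_inverse mult.commute)
  finally show thesis using c by (intro that[of "c2 / c1"]) (auto simp: g_def)
qed

theorem no_periodic_point:
  assumes N: "N > 0" and y: "y \<noteq> 0" and per: "(step ^^ N) (x, y) = (\<mu> * x, \<mu> * y)"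
  shows False
proof -
  define z where "z = x / y"
  obtain f where f: "f \<noteq> 0" "poly (map_poly emb f) z = 0"
    and minimal: "\<And>g. g \<noteq> 0 \<Longrightarrow> poly (map_poly emb g) z = 0 \<Longrightarrow> Polynomial.degree f \<le> Polynomial.degree g"
    and primitive: "\<And>\<alpha>. \<exists>j. poly (Polynomial.coeff f j) \<alpha> \<noteq> 0"
    using ex_minimal_primitive_root by blast
  define d where "d = Polynomial.degree f"
  obtain c where c: "c \<noteq> 0" "(pullback d ^^ N) f = smult [:c:] f"
    using minimal_form_periodic[OF N y per f[unfolded z_def] minimal[unfolded z_def] primitive d_def] by blast
  have d0: "d \<noteq> 0"
  proof
    assume "d = 0"
    then obtain a where "f = [:a:]" unfolding d_def by (metis degree_eq_zeroE)
    with f show False by (simp add: emb.map_poly_const)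
  qed
  \<comment> \<open>The derivative is nonzero of smaller degree, so by minimality it does not vanish
    at \<open>z\<close>; this supplies the Bezout identity.\<close>
  have "pderiv f \<noteq> 0" using d0 by (simp add: pderiv_eq_0_iff d_def)
  moreover have "\<not> Polynomial.degree f \<le> Polynomial.degree (pderiv f)"
    using d0 by (simp add: degree_pderiv d_def)
  ultimately have nz: "poly (map_poly emb (pderiv f)) z \<noteq> 0" using minimal by blast
  have inj: "a = 0" if "emb a = 0" for a using that by simp
  obtain a b r where "r \<noteq> 0" "a * f + b * pderiv f = [:r:]"
    by (rule bezout_of_minimal_root[OF emb.comm_ring_map_axioms f(2) minimal f(1) nz inj])
  then have "d \<le> 2" using periodic_form_degree_le_2[OF d_def[symmetric] N c(2)] by blast
  moreover have "d \<noteq> 1"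
  proof
    assume "d = 1"
    with c(2) d_def have "(pullback 1 ^^ N) f = smult [:c:] f" "Polynomial.degree f \<le> 1" by simp_all
    from periodic_linear_form_eq_0[OF N this(2,1) c(1)] f(1) show False by blast
  qed
  ultimately have d2: "d = 2" using d0 by linarith
  obtain e where e: "quadratic_disc f = [:e:]"
    by (rule quadratic_disc_periodic[OF N c(2)[unfolded d2]])
  define a0 a1 a2 where a012: "a0 = Polynomial.coeff f 0" "a1 = Polynomial.coeff f 1" "a2 = Polynomial.coeff f 2"
  have f_eq: "f = [:a0, a1, a2:]"
  proof (rule poly_eqI)
    fix i
    show "Polynomial.coeff f i = Polynomial.coeff [:a0, a1, a2:] i"
    proof (cases "i \<le> 2")
      case True
      then show ?thesis by (auto simp: a012 numeral_2_eq_2 le_Suc_eq)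
    next
      case False
      then show ?thesis using d2 d_def by (simp add: coeff_eq_0)
    qed
  qed
  have "a2 \<noteq> 0" using d2 d_def f(1) by (metis a012(3) leading_coeff_0_iff)
  \<comment> \<open>The discriminant is the constant \<open>e\<close>, so it has a constant complex
    square root and the quadratic formula applies.\<close>
  define s where "s = [:csqrt e:]"
  have "csqrt e * csqrt e = e" by (metis power2_csqrt power2_eq_square)
  then have "s * s = a1\<^sup>2 - 4 * a0 * a2"
    using e by (simp add: quadratic_disc_def a012 s_def)
  then have factor: "smult (4 * a2) f = [:a1 - s, 2 * a2:] * [:a1 + s, 2 * a2:]"
    unfolding f_eq by (simp add: algebra_simps power2_eq_square)
  have "poly (map_poly emb (smult (4 * a2) f)) z = 0" using f(2) by (simp add: emb.map_poly_smult)
  then have "poly (map_poly emb [:a1 - s, 2 * a2:]) z = 0 \<or> poly (map_poly emb [:a1 + s, 2 * a2:]) z = 0"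
    unfolding factor emb.map_poly_mult by simp
  \<comment> \<open>A linear polynomial with root \<open>z\<close> would undercut the minimal degree
    2.\<close>
  moreover have "poly (map_poly emb [:p, 2 * a2:]) z \<noteq> 0" for p
    using minimal[of "[:p, 2 * a2:]"] \<open>a2 \<noteq> 0\<close> d2 d_def by auto
  ultimately show False by blast
qed

end

section \<open>Closed subsets and automorphisms of the projective line\<close>

lemma proportional_refl: "v \<noteq> 0 \<Longrightarrow> proportional v v"
  by (auto simp: proportional_def intro!: exI[of _ 1])

lemma pt_eq_iff:
  assumes "v \<noteq> 0" "w \<noteq> 0"
  shows "pt v = pt w \<longleftrightarrow> proportional v w"
  using Quotient_rel[OF Quotient_proj, of v w] proportional_refl[OF assms(1)] proportional_refl[OF assms(2)]
  by blast

lemma proj_cases: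
  obtains v where "v \<noteq> 0" "p = pt v"
proof -
  have "proportional (proj_rep p) (proj_rep p)" by (rule Quotient_rep_reflp[OF Quotient_proj])
  moreover have "pt (proj_rep p) = p" by (rule Quotient_abs_rep[OF Quotient_proj])
  ultimately show thesis using that[of "proj_rep p"] by (auto simp: proportional_def)
qed

section \<open>Homogeneous polynomials at points of projective space\<close>

lemma eval_mpoly_scale:
  assumes "homogeneous d f"
  shows "eval_mpoly f (c *s v) = c ^ d * eval_mpoly f v"
  unfolding eval_mpoly_def sum_distrib_left
proof (intro sum.cong refl)
  fix m assume "m \<in> Poly_Mapping.keys f"
  then have "(\<Sum>i\<in>UNIV. Poly_Mapping.lookup m i) = d" using assms by (simp add: homogeneous_def)
  then have "(\<Prod>i\<in>UNIV. c ^ Poly_Mapping.lookup m i) = c ^ d" by (simp flip: power_sum)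
  then show "Poly_Mapping.lookup f m * (\<Prod>i\<in>UNIV. (c *s v) $ i ^ Poly_Mapping.lookup m i) =
      c ^ d * (Poly_Mapping.lookup f m * (\<Prod>i\<in>UNIV. v $ i ^ Poly_Mapping.lookup m i))"
    by (simp add: power_mult_distrib prod.distrib)
qed

lemma vanishes_at_pt:
  assumes "homogeneous d f" "v \<noteq> 0"
  shows "vanishes_at f (pt v) \<longleftrightarrow> eval_mpoly f v = 0"
proof
  assume *: "eval_mpoly f v = 0"
  show "vanishes_at f (pt v)" unfolding vanishes_at_def
  proof (intro allI impI)
    fix w assume "w \<noteq> 0 \<and> pt v = pt w"
    then have "proportional v w" using pt_eq_iff[OF assms(2), of w] by simp
    then obtain c where "w = c *s v" by (auto simp: proportional_def)
    then show "eval_mpoly f w = 0" using * eval_mpoly_scale[OF assms(1)] by simp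
  qed
next
  assume "vanishes_at f (pt v)"
  then show "eval_mpoly f v = 0" using assms(2) unfolding vanishes_at_def by simp
qed

lemma eval_mpoly_superset:
  assumes "Poly_Mapping.keys f \<subseteq> A" "finite A"
  shows "eval_mpoly f v = (\<Sum>m\<in>A. Poly_Mapping.lookup f m * (\<Prod>i\<in>UNIV. v $ i ^ Poly_Mapping.lookup m i))"
  unfolding eval_mpoly_def using assms by (intro sum.mono_neutral_left) (auto simp: in_keys_iff)

lemma eval_mpoly_map:
  assumes "comm_ring_map g" "\<And>x. g x = 0 \<longleftrightarrow> x = 0"
  shows "eval_mpoly (Poly_Mapping.map g f) (\<chi> i. g (v $ i)) = g (eval_mpoly f v)"
proof -
  interpret comm_ring_map g by fact
  have lookup: "Poly_Mapping.lookup (Poly_Mapping.map g f) m = g (Poly_Mapping.lookup f m)" for m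
    by (simp add: map.rep_eq when_def map_zero)
  then have "Poly_Mapping.keys (Poly_Mapping.map g f) = Poly_Mapping.keys f"
    by (simp add: set_eq_iff in_keys_iff assms(2))
  with lookup show ?thesis
    by (simp add: eval_mpoly_def map_sum map_mult map_prod map_power)
qed

lemma homogeneous_map:
  assumes "homogeneous d f"
  shows "homogeneous d (Poly_Mapping.map g f)"
proof -
  have "m \<in> Poly_Mapping.keys f" if "m \<in> Poly_Mapping.keys (Poly_Mapping.map g f)" for m
  proof (rule ccontr)
    assume "m \<notin> Poly_Mapping.keys f"
    then have "Poly_Mapping.lookup (Poly_Mapping.map g f) m = 0"
      by (simp add: in_keys_iff map.rep_eq when_def)
    with that show False by (simp add: in_keys_iff)
  qed
  with assms show ?thesis by (simp add: homogeneous_def)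
qed

lemma zariski_closed_UNIV: "zariski_closed UNIV"
  unfolding zariski_closed_def by (intro exI[of _ "{}"]) (simp add: zero_locus_def)

lemma zariski_closed_empty: "zariski_closed ({} :: ('k::alg_closed_field, 'n::finite) proj set)"
  unfolding zariski_closed_def
proof (intro exI[of _ "{Poly_Mapping.single 0 1}"] conjI ballI)
  have hom: "homogeneous 0 (Poly_Mapping.single 0 1 :: ('k, 'n) mpoly)" by (simp add: homogeneous_def)
  then show "\<exists>d. homogeneous d f" if "f \<in> {Poly_Mapping.single 0 1}" for f :: "('k, 'n) mpoly"
    using that by auto
  have "\<not> vanishes_at (Poly_Mapping.single 0 1) p" for p :: "('k, 'n) proj"
  proof (cases p rule: proj_cases)
    case (1 v)
    then show ?thesis using vanishes_at_pt[OF hom 1(1)] by (simp add: eval_mpoly_def)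
  qed
  then show "{} = zero_locus {Poly_Mapping.single 0 1 :: ('k, 'n) mpoly}" by (simp add: zero_locus_def)
qed

lemma eval_mpoly_line:
  fixes f :: "('k::field, 'n::finite) mpoly"
  obtains q where "\<And>s. poly q s = eval_mpoly f (v + s *s w)"
proof
  show "poly (\<Sum>m\<in>Poly_Mapping.keys f. smult (Poly_Mapping.lookup f m)
      (\<Prod>i\<in>UNIV. [:v $ i, w $ i:] ^ Poly_Mapping.lookup m i)) s = eval_mpoly f (v + s *s w)" for s
    by (simp add: eval_mpoly_def poly_sum poly_prod)
qed

text \<open>Some defining form is nonzero at a point \<open>pt v\<close>. All points but
  \<open>pt w\<close> lie on the affine line \<open>v + s *s w\<close>, where the form restricts to
  a nonzero polynomial in \<open>s\<close>.\<close>

lemma finite_proper_zariski_closed: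
  fixes Y :: "('k::alg_closed_field, 2) proj set"
  assumes "zariski_closed Y" "Y \<noteq> UNIV"
  shows "finite Y"
proof -
  from assms obtain S p where S: "\<And>f. f \<in> S \<Longrightarrow> \<exists>d. homogeneous d f" "Y = zero_locus S" "p \<notin> Y"
    by (auto simp: zariski_closed_def)
  then obtain f where "f \<in> S" "\<not> vanishes_at f p" by (auto simp: zero_locus_def)
  with S(1) obtain d where f: "f \<in> S" "homogeneous d f" "\<not> vanishes_at f p" by blast
  obtain v where v: "v \<noteq> 0" "p = pt v" by (rule proj_cases)
  then have fv: "eval_mpoly f v \<noteq> 0" using f vanishes_at_pt by blast
  \<comment> \<open>A coordinate vector that completes \<open>v\<close> to a basis.\<close>
  define w :: "'k ^ 2" where "w = (if v $ 1 = 0 then vector [1, 0] else vector [0, 1])"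
  have span: "\<exists>a b. u = a *s v + b *s w" for u :: "'k ^ 2"
  proof (cases "v $ 1 = 0")
    case True
    then have "v $ 2 \<noteq> 0" using v by (auto simp: vec_eq_iff forall_2)
    then show ?thesis using True
      by (intro exI[of _ "u $ 2 / v $ 2"] exI[of _ "u $ 1"]) (auto simp: vec_eq_iff forall_2 w_def)
  next
    case False
    then show ?thesis
      by (intro exI[of _ "u $ 1 / v $ 1"] exI[of _ "u $ 2 - u $ 1 / v $ 1 * v $ 2"])
         (auto simp: vec_eq_iff forall_2 w_def)
  qed
  obtain q where q: "\<And>s. poly q s = eval_mpoly f (v + s *s w)" using eval_mpoly_line by blast
  have "poly q 0 \<noteq> 0" using q[of 0] fv by simp
  then have fin: "finite {s. poly q s = 0}" by (intro poly_roots_finite) auto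
  have "Y \<subseteq> insert (pt w) ((\<lambda>s. pt (v + s *s w)) ` {s. poly q s = 0})"
  proof
    fix y assume "y \<in> Y"
    obtain u where u: "u \<noteq> 0" "y = pt u" by (rule proj_cases)
    obtain a b where ab: "u = a *s v + b *s w" using span by blast
    have fu: "eval_mpoly f u = 0"
      using \<open>y \<in> Y\<close> S(2) f(1) u vanishes_at_pt[OF f(2) u(1)] by (auto simp: zero_locus_def)
    show "y \<in> insert (pt w) ((\<lambda>s. pt (v + s *s w)) ` {s. poly q s = 0})"
    proof (cases "a = 0")
      case True
      then have "proportional w u" using ab u(1) unfolding proportional_def by auto
      then have "y = pt w" using u pt_eq_iff[of w u] by (auto simp: proportional_def)
      then show ?thesis by simp
    next
      case False
      then have u': "u = a *s (v + (b / a) *s w)" using ab by (simp add: vec_eq_iff field_simps)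
      then have nz: "v + (b / a) *s w \<noteq> 0" using u(1) by auto
      have "proportional (v + (b / a) *s w) u" unfolding proportional_def using u' nz u(1) False by blast
      then have "y = pt (v + (b / a) *s w)" using u pt_eq_iff[OF nz u(1)] by simp
      moreover have "poly q (b / a) = 0"
        using fu eval_mpoly_scale[OF f(2), of a "v + (b / a) *s w"] False unfolding q u'[symmetric] by simp
      ultimately show ?thesis by blast
    qed
  qed
  with fin show ?thesis by (meson finite_imageI finite_insert finite_subset)
qed

lemma vector2_eq_0_iff: "(vector [x, y] :: 'a::zero ^ 2) = 0 \<longleftrightarrow> x = 0 \<and> y = 0"
  by (auto simp: vec_eq_iff forall_2)

lemma infinite_proj_line:
  assumes "infinite (UNIV :: 'k set)"
  shows "infinite (UNIV :: ('k::field, 2) proj set)"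
proof
  assume *: "finite (UNIV :: ('k, 2) proj set)"
  have "inj (\<lambda>x :: 'k. pt (vector [x, 1] :: 'k ^ 2))"
  proof (rule injI)
    fix x y :: 'k assume "pt (vector [x, 1] :: 'k ^ 2) = pt (vector [y, 1])"
    then have "proportional (vector [x, 1] :: 'k ^ 2) (vector [y, 1])"
      by (subst (asm) pt_eq_iff) (simp_all add: vector2_eq_0_iff)
    then show "x = y" by (auto simp: proportional_def vec_eq_iff forall_2)
  qed
  then have "infinite (range (\<lambda>x :: 'k. pt (vector [x, 1] :: 'k ^ 2)))"
    using assms finite_imageD by blast
  with * show False using finite_subset[OF subset_UNIV] by blast
qed

text \<open>Two proper closed subsets are finite and cannot cover an infinite line.\<close>

lemma irreducible_variety_proj_line:
  assumes "infinite (UNIV :: 'k set)"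
  shows "irreducible_variety (UNIV :: ('k::alg_closed_field, 2) proj set)"
  unfolding irreducible_variety_def
proof (intro conjI allI impI zariski_closed_UNIV)
  fix A B :: "('k, 2) proj set"
  assume AB: "zariski_closed A \<and> zariski_closed B \<and> UNIV \<subseteq> A \<union> B"
  show "UNIV \<subseteq> A \<or> UNIV \<subseteq> B"
  proof (rule ccontr)
    assume "\<not> ?thesis"
    then have "finite (A \<union> B)" using AB finite_proper_zariski_closed by auto
    with AB infinite_proj_line[OF assms] finite_subset show False by blast
  qed
qed simp

section \<open>Linear automorphisms of the projective line\<close>

definition linear_mpoly :: "'k \<Rightarrow> 'k \<Rightarrow> ('k::comm_ring_1, 2) mpoly" where
  "linear_mpoly a b = Poly_Mapping.single (Poly_Mapping.single 1 1) a + Poly_Mapping.single (Poly_Mapping.single 2 1) b"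

lemma keys_linear_mpoly:
  "Poly_Mapping.keys (linear_mpoly a b) \<subseteq> {Poly_Mapping.single 1 1, Poly_Mapping.single 2 1}"
  unfolding linear_mpoly_def by (rule order.trans[OF Poly_Mapping.keys_add]) auto

lemma single_1_neq_single_2: "Poly_Mapping.single (1 :: 2) (1 :: nat) \<noteq> Poly_Mapping.single 2 1"
proof
  assume "Poly_Mapping.single (1 :: 2) (1 :: nat) = Poly_Mapping.single 2 1"
  from arg_cong[OF this, of "\<lambda>m. Poly_Mapping.lookup m 1"] show False
    by (simp add: lookup_single)
qed

lemma homogeneous_linear_mpoly: "homogeneous 1 (linear_mpoly a b)"
  unfolding homogeneous_def using keys_linear_mpoly[of a b]
  by (auto simp: UNIV_2 lookup_single)

lemma eval_linear_mpoly: "eval_mpoly (linear_mpoly a b) v = a * v $ 1 + b * v $ 2"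
  using single_1_neq_single_2
  by (subst eval_mpoly_superset[OF keys_linear_mpoly])
     (auto simp: linear_mpoly_def lookup_add lookup_single UNIV_2)

text \<open>One pair of linear forms without common zero describes the map on the whole line, so
  \<open>U = UNIV\<close> serves at every point.\<close>

lemma variety_morphism_linear:
  fixes \<phi> :: "('k::alg_closed_field, 2) proj \<Rightarrow> ('k, 2) proj"
  assumes "\<And>v :: 'k ^ 2. v \<noteq> 0 \<Longrightarrow> (vector [a * v $ 1 + b * v $ 2, c * v $ 1 + e * v $ 2] :: 'k ^ 2) \<noteq> 0"
    and "\<And>v. v \<noteq> 0 \<Longrightarrow> \<phi> (pt v) = pt (vector [a * v $ 1 + b * v $ 2, c * v $ 1 + e * v $ 2])"
  shows "variety_morphism UNIV UNIV \<phi>"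
  unfolding variety_morphism_def
proof (intro conjI ballI)
  define F :: "2 \<Rightarrow> ('k, 2) mpoly" where "F i = (if i = 1 then linear_mpoly a b else linear_mpoly c e)" for i
  have F: "(\<chi> i. eval_mpoly (F i) v) = vector [a * v $ 1 + b * v $ 2, c * v $ 1 + e * v $ 2]" for v
    by (simp add: vec_eq_iff forall_2 F_def eval_linear_mpoly)
  have hom: "homogeneous 1 (F i)" for i
    unfolding F_def using homogeneous_linear_mpoly by auto
  show "\<exists>U d. \<exists>F :: 2 \<Rightarrow> ('k, 2) mpoly. zariski_closed (- U) \<and> p \<in> U \<and> (\<forall>i. homogeneous d (F i)) \<and>
      (\<forall>v. v \<noteq> 0 \<and> pt v \<in> UNIV \<inter> U \<longrightarrow>
        (\<chi> i. eval_mpoly (F i) v) \<noteq> 0 \<and> \<phi> (pt v) = pt (\<chi> i. eval_mpoly (F i) v))" for p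
    using assms hom by (intro exI[of _ UNIV] exI[of _ 1] exI[of _ F]) (simp add: F zariski_closed_empty)
qed simp

lemma infinite_K: "infinite (UNIV :: K set)"
proof -
  have "inj emb" by (auto simp: inj_def emb_def)
  moreover have "infinite (UNIV :: complex poly set)" by (rule infinite_UNIV_char_0)
  ultimately show ?thesis by (meson finite_imageD finite_subset subset_UNIV)
qed

lift_definition inverse_phi :: "(K, 2) proj \<Rightarrow> (K, 2) proj" is
  "\<lambda>v. vector [v $ 2 - t_K * v $ 1, v $ 1]"
proof -
  fix v w :: "K ^ 2"
  assume "proportional v w"
  then obtain c where *: "v \<noteq> 0" "w \<noteq> 0" "c \<noteq> 0" "w = c *s v"
    by (auto simp: proportional_def)
  have nz: "vector [u $ 2 - t_K * u $ 1, u $ 1] \<noteq> (0 :: K ^ 2)" if "u \<noteq> 0" for u :: "K ^ 2"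
    using that by (auto simp: vec_eq_iff forall_2)
  have "vector [w $ 2 - t_K * w $ 1, w $ 1] = c *s (vector [v $ 2 - t_K * v $ 1, v $ 1] :: K ^ 2)"
    using * by (simp add: vec_eq_iff forall_2 algebra_simps)
  with nz * show "proportional (vector [v $ 2 - t_K * v $ 1, v $ 1])
      (vector [w $ 2 - t_K * w $ 1, w $ 1] :: K ^ 2)"
    unfolding proportional_def by blast
qed

lemma phi_pt_vec: "v \<noteq> 0 \<Longrightarrow> phi (pt v) = pt (vector [v $ 2, v $ 1 + t_K * v $ 2])"
  by (simp add: phi.abs_eq proportional_refl)

lemma inverse_phi_pt: "v \<noteq> 0 \<Longrightarrow> inverse_phi (pt v) = pt (vector [v $ 2 - t_K * v $ 1, v $ 1])"
  by (simp add: inverse_phi.abs_eq proportional_refl)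

lemma variety_isomorphism_phi: "variety_isomorphism UNIV UNIV phi"
  unfolding variety_isomorphism_def
proof (intro conjI exI[of _ inverse_phi] ballI)
  show "variety_morphism UNIV UNIV phi"
    by (rule variety_morphism_linear[where a = 0 and b = 1 and c = 1 and e = t_K])
       (auto simp: phi_pt_vec vector2_eq_0_iff vec_eq_iff forall_2)
  show "variety_morphism UNIV UNIV inverse_phi"
    by (rule variety_morphism_linear[where a = "- t_K" and b = 1 and c = 1 and e = 0])
       (auto simp: inverse_phi_pt vector2_eq_0_iff vec_eq_iff forall_2)
next
  fix p :: "(K, 2) proj"
  obtain v where v: "v \<noteq> 0" "p = pt v" by (rule proj_cases)
  then have *: "v $ 1 \<noteq> 0 \<or> v $ 2 \<noteq> 0" by (auto simp: vec_eq_iff forall_2)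
  have v': "vector [v $ 1, v $ 2] = v" by (simp add: vec_eq_iff forall_2)
  have nz: "(vector [v $ 2, v $ 1 + t_K * v $ 2] :: K ^ 2) \<noteq> 0"
    "(vector [v $ 2 - t_K * v $ 1, v $ 1] :: K ^ 2) \<noteq> 0"
    using * by (auto simp: vector2_eq_0_iff)
  show "inverse_phi (phi p) = p" "phi (inverse_phi p) = p"
    using v v' nz by (auto simp: phi_pt_vec inverse_phi_pt)
qed

section \<open>Transforms of closed sets and wildness\<close>

context shift_automorphism
begin

text \<open>Evaluation commutes with applying \<open>\<sigma>\<close> to coefficients and
  coordinates alike, so a transformed form vanishes at \<open>w\<close> only if the original one
  vanishes at the preimage of \<open>w\<close>.\<close>

lemma mem_transformD:
  assumes "zariski_closed Y" "w \<noteq> 0" "pt w \<in> transform \<sigma> Y"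
  shows "pt (\<chi> i. \<tau> (w $ i)) \<in> Y"
proof -
  from assms(1) obtain S where S: "\<And>f. f \<in> S \<Longrightarrow> \<exists>d. homogeneous d f" "Y = zero_locus S"
    by (auto simp: zariski_closed_def)
  have nz: "(\<chi> i. \<tau> (w $ i)) \<noteq> 0" using assms(2) by (simp add: vec_eq_iff)
  have "vanishes_at f (pt (\<chi> i. \<tau> (w $ i)))" if "f \<in> S" for f
  proof -
    obtain d where d: "homogeneous d f" using S(1)[OF \<open>f \<in> S\<close>] by blast
    have "vanishes_at (Poly_Mapping.map \<sigma> f) (pt w)"
      using assms(3) d that S(2) unfolding transform_def zero_locus_def by blast
    then have "eval_mpoly (Poly_Mapping.map \<sigma> f) w = 0"
      using vanishes_at_pt[OF homogeneous_map[OF d] assms(2)] by blast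
    moreover have "w = (\<chi> i. \<sigma> ((\<chi> i. \<tau> (w $ i)) $ i))" by (simp add: vec_eq_iff)
    ultimately have "\<sigma> (eval_mpoly f (\<chi> i. \<tau> (w $ i))) = 0"
      using eval_mpoly_map[OF \<sigma>.comm_ring_map_axioms \<sigma>_eq_0_iff, of f "\<chi> i. \<tau> (w $ i)"] by metis
    then show ?thesis using vanishes_at_pt[OF d nz] by simp
  qed
  then show ?thesis by (simp add: S(2) zero_locus_def)
qed

lemma transform_UNIV: "transform \<sigma> (UNIV :: (K, 'n::finite) proj set) = UNIV"
proof -
  have "vanishes_at (Poly_Mapping.map \<sigma> f) p"
    if f: "homogeneous d f" "\<And>p. vanishes_at f p" for f :: "(K, 'n) mpoly" and d p
  proof -
    obtain w where w: "w \<noteq> 0" "p = pt w" by (rule proj_cases)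
    have nz: "(\<chi> i. \<tau> (w $ i)) \<noteq> 0" using w(1) by (simp add: vec_eq_iff)
    have "w = (\<chi> i. \<sigma> ((\<chi> i. \<tau> (w $ i)) $ i))" by (simp add: vec_eq_iff)
    then have "eval_mpoly (Poly_Mapping.map \<sigma> f) w = \<sigma> (eval_mpoly f (\<chi> i. \<tau> (w $ i)))"
      using eval_mpoly_map[OF \<sigma>.comm_ring_map_axioms \<sigma>_eq_0_iff, of f "\<chi> i. \<tau> (w $ i)"] by metis
    also have "\<dots> = 0" using vanishes_at_pt[OF f(1) nz] f(2) by simp
    finally show ?thesis using vanishes_at_pt[OF homogeneous_map[OF f(1)] w(1)] w(2) by simp
  qed
  then show ?thesis by (auto simp: transform_def zero_locus_def)
qed

lemma step_scale: "step (c * x, c * y) = (\<tau> c * fst (step (x, y)), \<tau> c * snd (step (x, y)))"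
  by (simp add: step_def \<tau>.map_mult \<tau>.map_add algebra_simps)

text \<open>A proper invariant closed set is finite, so the orbit of one of its points under
  \<open>step\<close> repeats a point, which gives a vector periodic up to a scalar.\<close>

lemma wild_phi: "wild \<sigma> UNIV phi"
  unfolding wild_def
proof (intro allI impI, elim conjE)
  fix Y :: "(K, 2) proj set"
  assume Y: "Y \<noteq> {}" "zariski_closed Y" "phi ` Y \<subseteq> transform \<sigma> Y"
  show "Y = UNIV"
  proof (rule ccontr)
    assume "Y \<noteq> UNIV"
    then have fin: "finite Y" using finite_proper_zariski_closed Y(2) by blast
    define vec :: "K \<times> K \<Rightarrow> K ^ 2" where "vec v = vector [fst v, snd v]" for v
    have vec0: "vec v = 0 \<longleftrightarrow> v = (0, 0)" for v by (cases v) (simp add: vec_def vector2_eq_0_iff)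
    have inv: "step v \<noteq> (0, 0) \<and> pt (vec (step v)) \<in> Y" if "v \<noteq> (0, 0)" "pt (vec v) \<in> Y" for v
    proof
      show nz: "step v \<noteq> (0, 0)" using that(1) by (cases v) (auto simp: step_def)
      have "phi (pt (vec v)) \<in> transform \<sigma> Y" using Y(3) that(2) by blast
      then have mem: "pt (vector [snd v, fst v + t_K * snd v]) \<in> transform \<sigma> Y"
        using that(1) by (simp add: phi_pt_vec vec0) (simp add: vec_def)
      have "(vector [snd v, fst v + t_K * snd v] :: K ^ 2) \<noteq> 0"
        using that(1) by (cases v) (auto simp: vector2_eq_0_iff)
      from mem_transformD[OF Y(2) this mem]
      have "pt (\<chi> i. \<tau> ((vector [snd v, fst v + t_K * snd v] :: K ^ 2) $ i)) \<in> Y" .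
      moreover have "(\<chi> i. \<tau> ((vector [snd v, fst v + t_K * snd v] :: K ^ 2) $ i)) = vec (step v)"
        by (simp add: vec_def step_def vec_eq_iff forall_2)
      ultimately show "pt (vec (step v)) \<in> Y" by simp
    qed
    obtain p where "p \<in> Y" using Y(1) by blast
    obtain u where u: "u \<noteq> 0" "p = pt u" by (rule proj_cases)
    define s where "s n = (step ^^ n) (u $ 1, u $ 2)" for n
    have s: "s n \<noteq> (0, 0) \<and> pt (vec (s n)) \<in> Y" for n
    proof (induction n)
      case 0
      have "vec (s 0) = u" by (simp add: vec_def s_def vec_eq_iff forall_2)
      with u \<open>p \<in> Y\<close> vec0[of "s 0"] show ?case by auto
    next
      case (Suc n)
      have "s (Suc n) = step (s n)" by (simp add: s_def)
      with inv Suc show ?case by auto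
    qed
    have "\<not> inj (\<lambda>n. pt (vec (s n)))"
      using fin s finite_subset[of "range (\<lambda>n. pt (vec (s n)))" Y] range_inj_infinite by blast
    then obtain i j where ij: "i < j" "pt (vec (s i)) = pt (vec (s j))"
      unfolding inj_def by (metis linorder_neqE_nat)
    then have "proportional (vec (s i)) (vec (s j))" using s vec0 by (subst (asm) pt_eq_iff) auto
    then obtain c where c: "vec (s j) = c *s vec (s i)" by (auto simp: proportional_def)
    obtain x y where xy: "s i = (x, y)" by (cases "s i")
    have sj: "s j = (c * x, c * y)"
      using c by (cases "s j") (auto simp: xy vec_def vec_eq_iff forall_2)
    define N where "N = j - i"
    have "N > 0" using ij by (simp add: N_def)
    have "s j = (step ^^ N) (s i)" using ij(1) 
      using funpow_add[of N i step] by (simp add: s_def N_def)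
    then have per: "(step ^^ N) (x, y) = (c * x, c * y)" by (simp add: sj xy)
    show False
    proof (cases "y = 0")
      case False
      from no_periodic_point[OF \<open>N > 0\<close> False per] show False .
    next
      \<comment> \<open>From the point with \<open>y = 0\<close> one more step leads to the nonzero
        second coordinate \<open>\<tau> x\<close>, again with period \<open>N\<close>, now with
        multiplier \<open>\<tau> c\<close>.\<close>
      case True
      obtain x' y' where xy': "step (x, y) = (x', y')" by (cases "step (x, y)")
      have "x \<noteq> 0" using s[of i] xy True by auto
      then have "y' \<noteq> 0" using xy' True by (auto simp: step_def)
      moreover have "(step ^^ N) (x', y') = (\<tau> c * x', \<tau> c * y')"
      proof -
        have "(step ^^ N) (x', y') = step ((step ^^ N) (x, y))" by (simp only: xy'[symmetric] funpow_swap1)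
        then show ?thesis by (simp add: per step_scale xy')
      qed
      ultimately show False using no_periodic_point[OF \<open>N > 0\<close>] by blast
    qed
  qed
qed

end

theorem corollary3p9:
  fixes \<sigma> :: "K \<Rightarrow> K"
  assumes "field_automorphism \<sigma>"
    and "\<And>c. \<sigma> (const_K c) = const_K c"
    and "\<sigma> t_K = t_K + 1"
  shows "inversive_sigma_variety \<sigma> (UNIV :: (K, 2) proj set) phi
       \<and> wild \<sigma> (UNIV :: (K, 2) proj set) phi"
proof -
  interpret shift_automorphism \<sigma>
    using assms by unfold_locales
  show ?thesis
    by (simp add: inversive_sigma_variety_def assms(1) irreducible_variety_proj_line infinite_K
        transform_UNIV variety_isomorphism_phi wild_phi)
qed

end
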